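(* Let $F$ and $G$ be continuous cumulative distribution functions on $\mathbb{R}$. Let $X_1,\dots,X_n$ be i.i.d. with distribution function $F$ and $Y_1,\dots,Y_m$ be i.i.d. with distribution function $G$ ($n,m\ge1$), the two samples being independent of each other, with empirical distribution functions $F_n$ and $G_m$. Then for all $z\ge\sqrt{\log(2)/2}\,\bigl(n^{-1/2}+m^{-1/2}\bigr)$, $$\mathrm{Prob}\Big[|d(F_n,G_m)-d(F,G)|>z\Big]\ \le\ B(n,m,z)+B(m,n,z),$$ where $$B(n,m,z):=\frac{n}{m+n}\,2^{1-\frac{m}{n}}\,e^{-2mz\left(z-\sqrt{\frac{\log 4}{n}}\right)}+\sqrt{32\pi}\,z\,\frac{mn}{(m+n)^{3/2}}\,e^{-\frac{2mnz^2}{m+n}}\,\mathrm{erf}\left(\sqrt{\frac{2m^2z^2}{m+n}}-\sqrt{\frac{(m+n)\log 2}{n}}\right).$$ In particular, for $n=m$, $$\mathrm{Prob}\left[\sqrt{\frac{n}{2}}\,|d(F_n,G_n)-d(F,G)|>z\right]\ \le\ \alpha_1(z):=e^{-4z\left(z-\sqrt{\log 2}\right)}+\sqrt{32\pi}\,z\,e^{-2z^2}\,\mathrm{erf}\left[\sqrt2\left(z-\sqrt{\log 2}\right)\right]$$ for all $z\ge\sqrt{\log 2}$.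
   Context: For two distribution functions $A,B$ on $\mathbb{R}$ (cumulative or empirical), the Kolmogorov-Smirnov distance is $d(A,B):=\sup_{x\in\mathbb{R}}|A(x)-B(x)|$. The empirical distribution functions are $F_n(x)=\frac1n\sum_{i=1}^n I(X_i\le x)$ and $G_m(x)=\frac1m\sum_{i=1}^m I(Y_i\le x)$, where $I$ denotes the indicator. $\log$ is the natural logarithm and $\mathrm{erf}(t)=\frac{2}{\sqrt\pi}\int_0^t e^{-s^2}\,ds$ (an odd function, defined for all real $t$). *)

theory Defs
  imports "HOL-Probability.Probability"
begin

definition is_cdf :: "(real \<Rightarrow> real) \<Rightarrow> bool" where
  "is_cdf F \<longleftrightarrow> (\<exists>P. real_distribution P \<and> F = cdf P)"

(* For functions with values in [0,1], as here, the supremum is over a bounded set. *)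
definition ks_dist :: "(real \<Rightarrow> real) \<Rightarrow> (real \<Rightarrow> real) \<Rightarrow> real" where
  "ks_dist A B = (SUP x. \<bar>A x - B x\<bar>)"

definition ecdf :: "nat \<Rightarrow> (nat \<Rightarrow> real) \<Rightarrow> real \<Rightarrow> real" where
  "ecdf n x t = 1 / real n * (\<Sum>i=1..n. indicator {..t} (x i))"

(* The interval integral is oriented, so this is the odd function also for t < 0. *)
definition erf :: "real \<Rightarrow> real" where
  "erf t = 2 / sqrt pi * (LBINT s=0..ereal t. exp (- s\<^sup>2))"

definition ks_bound :: "nat \<Rightarrow> nat \<Rightarrow> real \<Rightarrow> real" where
  "ks_bound n m z =
     real n / (real m + real n) * 2 powr (1 - real m / real n)
       * exp (- 2 * real m * z * (z - sqrt (ln 4 / real n)))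
     + sqrt (32 * pi) * z * (real m * real n / (real m + real n) powr (3 / 2))
       * exp (- (2 * real m * real n * z\<^sup>2 / (real m + real n)))
       * erf (sqrt (2 * (real m)\<^sup>2 * z\<^sup>2 / (real m + real n))
              - sqrt ((real m + real n) * ln 2 / real n))"

definition ks_alpha1 :: "real \<Rightarrow> real" where
  "ks_alpha1 z =
     exp (- 4 * z * (z - sqrt (ln 2)))
     + sqrt (32 * pi) * z * exp (- 2 * z\<^sup>2) * erf (sqrt 2 * (z - sqrt (ln 2)))"

end

theory Submission
  imports Defs
begin

text \<open>By the triangle inequality the deviation is at most \<open>d(F\<^sub>n, F) + d(G\<^sub>m, G)\<close>, a sum of independent
  variables with the Dvoretzky-Kiefer-Wolfowitz-Massart tails \<open>2 exp (-2nu\<^sup>2)\<close> and \<open>2 exp (-2mv\<^sup>2)\<close>. Convolving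
  two variables whose tails are exactly the minima of these with 1 gives the stated bound as an equality.

  Massart's one-sided tail \<open>exp (-2nu\<^sup>2)\<close> is obtained as follows. For \<open>n\<close> points in \<open>[0, A]\<close> let \<open>V\<^sub>n(A)\<close> be the
  volume of the configurations for which some \<open>[0, a]\<close> contains more than \<open>a + y\<close> points. Conditioning on the
  largest point gives \<open>V\<^sub>n(A) \<le> (n - y)\<^sup>n + n \<integral> V\<^sub>n\<^sub>-\<^sub>1(s) ds\<close> over \<open>[n - y, A]\<close>, and
  \<open>A\<^sup>n exp (-6y(A - n + y) / (n + 2A))\<close> is a supersolution of this recursion. At \<open>A = n\<close> its exponent
  is \<open>-2y\<^sup>2/n\<close>. The exponent is the Brownian bridge rate \<open>2yB/n\<close>, \<open>B = A - n + y\<close>, with the denominator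
  changed so that the recursion also holds to next order.\<close>

section \<open>A drift inequality\<close>

lemma nonneg_of_deriv_nonneg:
  fixes f f' :: "real \<Rightarrow> real"
  assumes "f 0 = 0" "\<And>t. (f has_real_derivative f' t) (at t)" "\<And>t. 0 \<le> t \<Longrightarrow> 0 \<le> f' t" "0 \<le> x"
  shows "0 \<le> f x"
  using DERIV_nonneg_imp_nondecreasing[of 0 x f] assms by metis

text \<open>The quotient is the [2/2] Pade approximant of exp (-x). Multiplied by exp x, the
  difference of the two sides and its first two derivatives vanish at 0, and its third derivative is
  \<open>exp t * t^2\<close>. \<open>drift_inequality\<close> needs a bound that is exact to second
  order.\<close>

lemma exp_minus_le_pade:
  fixes x :: real
  assumes "0 \<le> x"
  shows "exp (- x) * (x\<^sup>2 + 6 * x + 12) \<le> x\<^sup>2 - 6 * x + 12"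
proof -
  have h2: "0 \<le> exp t * (t\<^sup>2 - 2 * t + 2) - 2" if "0 \<le> t" for t :: real
    by (rule nonneg_of_deriv_nonneg[where f' = "\<lambda>t. exp t * t\<^sup>2", OF _ _ _ that])
       (auto intro!: derivative_eq_intros simp: algebra_simps)
  have h1: "0 \<le> exp t * (t\<^sup>2 - 4 * t + 6) - 2 * t - 6" if "0 \<le> t" for t :: real
    by (rule nonneg_of_deriv_nonneg[where f' = "\<lambda>t. exp t * (t\<^sup>2 - 2 * t + 2) - 2", OF _ _ h2 that])
       (auto intro!: derivative_eq_intros simp: algebra_simps)
  have "0 \<le> exp x * (x\<^sup>2 - 6 * x + 12) - (x\<^sup>2 + 6 * x + 12)"
    by (rule nonneg_of_deriv_nonneg[where f' = "\<lambda>t. exp t * (t\<^sup>2 - 4 * t + 6) - 2 * t - 6", OF _ _ h1 assms])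
       (auto intro!: derivative_eq_intros simp: algebra_simps)
  then show ?thesis by (simp add: exp_minus field_simps)
qed

text \<open>Complete the square, here scaled by the constant coefficient and in the next lemma by
  the leading one. The other version is the right one where the constant term may vanish, as it does
  in \<open>drift_polynomial_nonneg\<close> at s = 2.\<close>

lemma quadratic_nonneg_of_discriminant_const:
  fixes a b c z :: real
  assumes "0 < a" "b\<^sup>2 \<le> 4 * a * c"
  shows "0 \<le> a + b * z + c * z\<^sup>2"
proof -
  have "0 \<le> (2 * a + b * z)\<^sup>2 + (4 * a * c - b\<^sup>2) * z\<^sup>2"
    using assms(2) by (intro add_nonneg_nonneg mult_nonneg_nonneg) auto
  also have "\<dots> = 4 * a * (a + b * z + c * z\<^sup>2)"
    by (simp add: power2_eq_square algebra_simps)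
  finally show ?thesis using assms(1) by (simp add: zero_le_mult_iff)
qed

lemma quadratic_nonneg_of_discriminant_lead:
  fixes a b c z :: real
  assumes "0 < c" "b\<^sup>2 \<le> 4 * a * c"
  shows "0 \<le> a + b * z + c * z\<^sup>2"
proof -
  have "0 \<le> (2 * c * z + b)\<^sup>2 + (4 * a * c - b\<^sup>2)"
    using assms(2) by (intro add_nonneg_nonneg) auto
  also have "\<dots> = 4 * c * (a + b * z + c * z\<^sup>2)"
    by (simp add: power2_eq_square algebra_simps)
  finally show ?thesis using assms(1) by (simp add: zero_le_mult_iff)
qed

text \<open>The polynomial arises in \<open>drift_inequality\<close> when the Pade bound is inserted
  and denominators are cleared. It vanishes at s = 2, z = 0, so no estimate may lose anything near
  that point.\<close>

lemma drift_polynomial_nonneg: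
  fixes s z :: real
  assumes s: "0 \<le> s" and z: "0 \<le> z" "z \<le> 1"
  shows "0 \<le> 8 * (1 + s)^5 - 6 * s * (3 - 2 * z) * (3 * s + 2 * z) * (1 + s)\<^sup>2
              - 3 * s * z * (3 - 2 * z) * (3 * s + 2 * z)\<^sup>2" (is "0 \<le> ?f")
proof -
  define a where "a = 2 * (1 + s)\<^sup>2 * (s - 2)\<^sup>2 * (4 * s + 1)"
  define b where "b = 9 * s * (s - 2) * (4 * s\<^sup>2 + 3 * s + 2)"
  define c where "c = 13 * s\<^sup>2 - 10 * s + 4"
  \<comment> \<open>Expansion in powers of z. At s = 2 the coefficient \<open>a\<close> has a double
    zero and \<open>b\<close> a simple one, which leaves room for a discriminant that is not
    positive.\<close>
  have f: "?f = a + b * z + 6 * s * z\<^sup>2 * (c + 6 * (2 * s - 1) * z + 4 * z\<^sup>2)"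
    unfolding a_def b_def c_def by algebra
  consider "s \<le> 1/6" | "1/6 \<le> s" "s \<le> 1" | "1 \<le> s" by linarith
  then show ?thesis
  proof cases
    case 1
    have "c + 6 * (2 * s - 1) * z + 4 * z\<^sup>2 = (2 * z + 3/2 * (2 * s - 1))\<^sup>2 + 4 * s\<^sup>2 + (7/4 - s)"
      unfolding c_def power2_eq_square by (simp add: field_simps)
    also have "\<dots> \<ge> 0" using 1 by auto
    finally have q: "0 \<le> 6 * s * z\<^sup>2 * (c + 6 * (2 * s - 1) * z + 4 * z\<^sup>2)" using s by auto
    have "0 \<le> s * (1 - s)" using s 1 by simp
    then have "2 \<le> (1 + s) * (2 - s)" by (simp add: algebra_simps)
    then have "2\<^sup>2 \<le> ((1 + s) * (2 - s))\<^sup>2" by (intro power_mono) auto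
    then have "2 * 4 * 1 \<le> 2 * ((1 + s) * (2 - s))\<^sup>2 * (4 * s + 1)"
      using s by (intro mult_mono) auto
    then have a: "8 \<le> a" unfolding a_def by (simp add: power2_eq_square algebra_simps)
    have "4 * s\<^sup>2 \<le> 4 * (1/6)\<^sup>2" using s 1 by (intro mult_left_mono power_mono) auto
    then have "s * (2 - s) * (4 * s\<^sup>2 + 3 * s + 2) \<le> 1/6 * 2 * (8/3)"
      using s 1 by (intro mult_mono) (auto simp: power2_eq_square)
    then have "- b \<le> 8" unfolding b_def by (simp add: algebra_simps)
    moreover have "b \<le> 0" unfolding b_def using s 1
      by (intro mult_nonneg_nonpos mult_nonpos_nonneg) auto
    ultimately have "-8 \<le> b * z" using z mult_left_mono_neg[of z 1 b] by auto
    then show ?thesis unfolding f using a q by linarith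
  next
    case 2
    define \<beta> where "\<beta> = 36 * s^3 - 45 * s\<^sup>2 - 54 * s - 33"
    define \<gamma> where "\<gamma> = 13 * s\<^sup>2 + 2 * s + 1"
    have z2: "0 \<le> (2 * z - 1)\<^sup>2" by simp
    \<comment> \<open>Lower the degree in z by the double root at z = 1/2: first z^4 is bounded
      below by z^3 - z^2/4, then z^3 by z^2 - z/4. The point 1/2 is the middle of the range of
      z.\<close>
    have "0 \<le> (12 * s - 2) * z * (2 * z - 1)\<^sup>2" using 2 z by (intro mult_nonneg_nonneg) auto
    moreover have "0 \<le> z\<^sup>2 * (2 * z - 1)\<^sup>2" by simp
    ultimately have "(12 * s - 2) * (z\<^sup>2 - z / 4) + z\<^sup>2 * (c - 1) \<le> z\<^sup>2 * (c + 6 * (2 * s - 1) * z + 4 * z\<^sup>2)"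
      by (simp add: power2_eq_square algebra_simps)
    then have "6 * s * ((12 * s - 2) * (z\<^sup>2 - z / 4) + z\<^sup>2 * (c - 1))
        \<le> 6 * s * (z\<^sup>2 * (c + 6 * (2 * s - 1) * z + 4 * z\<^sup>2))"
      using s by (intro mult_left_mono) auto
    moreover have "a + b * z + 6 * s * ((12 * s - 2) * (z\<^sup>2 - z / 4) + z\<^sup>2 * (c - 1))
        = a + (s * \<beta>) * z + (6 * s * \<gamma>) * z\<^sup>2"
      unfolding b_def c_def \<beta>_def \<gamma>_def by (simp add: power2_eq_square power3_eq_cube field_simps)
    moreover have "0 \<le> a + (s * \<beta>) * z + (6 * s * \<gamma>) * z\<^sup>2"
    proof (rule quadratic_nonneg_of_discriminant_const)
      have "0 \<le> s * (1 - s)" using 2 by simp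
      then have "2 \<le> (1 + s) * (2 - s)" by (simp add: algebra_simps)
      then have sq: "2\<^sup>2 \<le> ((1 + s) * (2 - s))\<^sup>2" by (intro power_mono) auto
      have a: "8 * (4 * s + 1) \<le> a"
        using mult_right_mono[OF sq, of "2 * (4 * s + 1)"] 2 unfolding a_def by (simp add: power2_eq_square algebra_simps)
      moreover have "0 < 8 * (4 * s + 1)" using s by simp
      ultimately show "0 < a" by (rule order.strict_trans2[rotated])
      \<comment> \<open>This square bounds the part 45 s^2 - 36 s^3 of \<open>- \<beta>\<close> by
        (225/16) s, which is at most 15 s.\<close>
      have "0 \<le> s * (6 * s - 15/4)\<^sup>2" using s by simp
      then have "- \<beta> \<le> 33 + 69 * s"
        unfolding \<beta>_def using 2 by (simp add: power2_eq_square power3_eq_cube algebra_simps)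
      moreover have "\<beta> \<le> 0"
      proof -
        have "(36 * s) * s\<^sup>2 \<le> 45 * s\<^sup>2" using 2 by (intro mult_right_mono) auto
        then have "36 * s^3 \<le> 45 * s\<^sup>2" by (simp add: power2_eq_square power3_eq_cube)
        then show ?thesis unfolding \<beta>_def using s by linarith
      qed
      ultimately have "\<bar>\<beta>\<bar>\<^sup>2 \<le> (33 + 69 * s)\<^sup>2" using 2 by (intro power_mono) auto
      then have "s * \<beta>\<^sup>2 \<le> s * (33 + 69 * s)\<^sup>2" using s by (intro mult_left_mono) auto
      also have "\<dots> \<le> 24 * (8 * (4 * s + 1)) * \<gamma>"
      proof -
        have "522 * s\<^sup>2 \<le> 5223 * s * s\<^sup>2" using 2 by (intro mult_right_mono) auto
        then show ?thesis unfolding \<gamma>_def using s by (simp add: power2_eq_square algebra_simps)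
      qed
      also have "\<dots> \<le> 24 * a * \<gamma>" using a 2 unfolding \<gamma>_def by (intro mult_right_mono) auto
      finally have "s * (s * \<beta>\<^sup>2) \<le> s * (24 * a * \<gamma>)" using s by (intro mult_left_mono) auto
      then show "(s * \<beta>)\<^sup>2 \<le> 4 * a * (6 * s * \<gamma>)" by (simp add: power2_eq_square algebra_simps)
    qed
    ultimately show ?thesis unfolding f by (simp add: mult.assoc)
  next
    case 3
    define r where "r = s - 1"
    have r: "0 \<le> r" and sr: "s = 1 + r" using 3 unfolding r_def by auto
    have c: "0 < c" unfolding c_def sr using r by (simp add: power2_eq_square algebra_simps add_pos_nonneg)
    have "6 * s * z\<^sup>2 * c \<le> 6 * s * z\<^sup>2 * (c + 6 * (2 * s - 1) * z + 4 * z\<^sup>2)"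
      using 3 z by (intro mult_left_mono) auto
    moreover have "0 \<le> a + b * z + (6 * s * c) * z\<^sup>2"
    proof (rule quadratic_nonneg_of_discriminant_lead)
      show "0 < 6 * s * c" using c 3 by simp
      \<comment> \<open>In terms of r = s - 1 all coefficients of this quintic are nonnegative. It
        is what remains of the discriminant after the factor 3 s (s - 2)^2 is split off.\<close>
      have "0 \<le> 400 * s^5 + 584 * s^4 - 611 * s^3 - 500 * s\<^sup>2 + 116 * s + 64"
        unfolding sr using r by (simp add: power2_eq_square power3_eq_cube power4_eq_xxxx algebra_simps numeral_eq_Suc)
      then have "0 \<le> 3 * s * (s - 2)\<^sup>2 * (400 * s^5 + 584 * s^4 - 611 * s^3 - 500 * s\<^sup>2 + 116 * s + 64)"
        using s by (intro mult_nonneg_nonneg) auto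
      also have "\<dots> = 4 * a * (6 * s * c) - b\<^sup>2"
        unfolding a_def b_def c_def by algebra
      finally show "b\<^sup>2 \<le> 4 * a * (6 * s * c)" by simp
    qed
    ultimately show ?thesis unfolding f by (simp add: algebra_simps)
  qed
qed

text \<open>One step of the volume recursion in scale-free form: \<open>crossing_weight_step\<close>
  takes s = 2A/n and z = y/n. Both sides agree to first order in z, and at s = 2, that is A = n,
  also to second order. By the Pade bound it suffices that
  \<open>12 * x - e * (x^2 + 6 * x + 12)\<close> is nonnegative; times \<open>T ^ 6\<close> this is
  9 z^2 times the polynomial of \<open>drift_polynomial_nonneg\<close>.\<close>

lemma drift_inequality:
  fixes s z :: real
  assumes s: "0 \<le> s" and z: "0 \<le> z" "z \<le> 1"
  shows "exp (- (3 * z * (3 * s + 2 * z) / (1 + s)\<^sup>2)) \<le> 1 - 3 * z * s * (3 - 2 * z) / (1 + s)\<^sup>2"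
proof -
  define T where "T = 1 + s"
  define w where "w = 3 * s + 2 * z"
  define x where "x = 3 * z * w / T\<^sup>2"
  define e where "e = 3 * z * s * (3 - 2 * z) / T\<^sup>2"
  have T: "T > 0" unfolding T_def using s by auto
  have w: "w \<ge> 0" unfolding w_def using s z by auto
  have x: "x \<ge> 0" unfolding x_def using w z T by auto
  have xT: "x * T\<^sup>2 = 3 * z * w" and eT: "e * T\<^sup>2 = 3 * z * s * (3 - 2 * z)"
    unfolding x_def e_def using T by auto
  have poly: "0 \<le> 9 * z\<^sup>2 * (8 * T^5 - 6 * s * (3 - 2 * z) * w * T\<^sup>2 - 3 * s * z * (3 - 2 * z) * w\<^sup>2)"
    using drift_polynomial_nonneg[OF s z] unfolding T_def w_def by (intro mult_nonneg_nonneg) auto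
  have "9 * z\<^sup>2 * (8 * T^5 - 6 * s * (3 - 2 * z) * w * T\<^sup>2 - 3 * s * z * (3 - 2 * z) * w\<^sup>2)
      = (12 * x - e * (x\<^sup>2 + 6 * x + 12)) * T ^ 6" 
  proof -
    have "(12 * x - e * (x\<^sup>2 + 6 * x + 12)) * T ^ 6
       = 12 * (x * T\<^sup>2) * T^4 - (e * T\<^sup>2) * ((x * T\<^sup>2)\<^sup>2 + 6 * (x * T\<^sup>2) * T\<^sup>2 + 12 * T^4)"
      by algebra
    then show ?thesis unfolding xT eT unfolding w_def T_def by algebra
  qed
  with poly have "0 \<le> 12 * x - e * (x\<^sup>2 + 6 * x + 12)"
    using T by (simp add: zero_le_mult_iff)
  then have "x\<^sup>2 - 6 * x + 12 \<le> (1 - e) * (x\<^sup>2 + 6 * x + 12)" by (simp add: algebra_simps)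
  with exp_minus_le_pade[OF x] have "exp (- x) * (x\<^sup>2 + 6 * x + 12) \<le> (1 - e) * (x\<^sup>2 + 6 * x + 12)"
    by linarith
  then show ?thesis
    using x add_nonneg_pos[of "x\<^sup>2 + 6 * x" 12]
    unfolding x_def[symmetric] e_def[symmetric] mult_le_cancel_right
    unfolding x_def e_def T_def w_def by auto
qed

section \<open>Crossing probability of uniform points\<close>

text \<open>The factor multiplying A^n in the supersolution. It equals 1 at A = n - y, where the
  recursion starts, and exp (-2y^2/n) at A = n, where it is evaluated in the end.\<close>

definition crossing_weight :: "real \<Rightarrow> nat \<Rightarrow> real \<Rightarrow> real" where
  "crossing_weight y n A = exp (- (6 * y * (A - real n + y) / (real n + 2 * A)))"

lemma crossing_weight_pos: "0 < crossing_weight y n A"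
  by (simp add: crossing_weight_def)

lemma has_derivative_crossing_weight:
  assumes "0 < A" "0 < n"
  shows "((\<lambda>A. A ^ n * crossing_weight y n A) has_real_derivative
     real n * A ^ (n - 1) * crossing_weight y n A
     - A ^ n * (crossing_weight y n A * (6 * y * (3 * real n - 2 * y) / (real n + 2 * A)\<^sup>2))) (at A)"
proof -
  have T: "real n + 2 * A \<noteq> 0" using assms by auto
  have "((\<lambda>A. 6 * y * (A - real n + y) / (real n + 2 * A)) has_real_derivative
     (6 * y * (3 * real n - 2 * y) / (real n + 2 * A)\<^sup>2)) (at A)"
    using T by (auto intro!: derivative_eq_intros simp: power2_eq_square) (simp add: field_simps)
  then have "((\<lambda>A. crossing_weight y n A) has_real_derivative
     - crossing_weight y n A * (6 * y * (3 * real n - 2 * y) / (real n + 2 * A)\<^sup>2)) (at A)"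
    unfolding crossing_weight_def mult_minus_left mult_minus_right[symmetric]
    by (intro DERIV_fun_exp DERIV_minus)
  from DERIV_mult[OF DERIV_pow[of n A] this] show ?thesis
    by (simp add: mult.commute)
qed

text \<open>The supersolution property in differentiated form: by
  \<open>has_derivative_crossing_weight\<close> the right side is the derivative of A^(k+1)
  \<open>crossing_weight y (Suc k) A\<close>, and the left side is the integrand of the recursion
  with the bound for k points inserted.\<close>

lemma crossing_weight_step:
  assumes A: "0 < A" and y: "0 < y" "y \<le> 1 + real k"
  shows "(1 + real k) * A ^ k * crossing_weight y k A
    \<le> (1 + real k) * A ^ k * crossing_weight y (Suc k) A
     - A ^ Suc k * (crossing_weight y (Suc k) A * (6 * y * (3 * (1 + real k) - 2 * y) / ((1 + real k) + 2 * A)\<^sup>2))"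
proof -
  define n where "n = 1 + real k"
  define T where "T = n + 2 * A"
  define W where "W = crossing_weight y (Suc k) A"
  have n: "1 \<le> n" unfolding n_def by auto
  have T: "1 < T" unfolding T_def using n A by auto
  have W: "0 < W" unfolding W_def by (rule crossing_weight_pos)
  have d: "exp (- (6 * y * (3 * A + y) / T\<^sup>2)) \<le> 1 - 6 * y * A * (3 * n - 2 * y) / (n * T\<^sup>2)"
  proof -
    have 1: "1 + 2 * A / n = T / n" unfolding T_def using n by (simp add: field_simps)
    have 2: "3 * (y / n) * (3 * (2 * A / n) + 2 * (y / n)) / (T / n)\<^sup>2 = 6 * y * (3 * A + y) / T\<^sup>2"
      using n T by (simp add: field_simps power2_eq_square)
    have 3: "3 * (y / n) * (2 * A / n) * (3 - 2 * (y / n)) / (T / n)\<^sup>2 = 6 * y * A * (3 * n - 2 * y) / (n * T\<^sup>2)"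
      using n T by (simp add: field_simps power2_eq_square)
    show ?thesis
      using drift_inequality[of "2 * A / n" "y / n"] A y n unfolding 1 2 3 by (simp add: n_def)
  qed
  \<comment> \<open>The exponents for k and for k + 1 points have denominators T - 1 and T, and
    their difference has denominator T (T - 1). Enlarging it to T^2 makes the expression homogeneous
    in n, A and y, as \<open>drift_inequality\<close> requires.\<close>
  have "6 * y * (3 * A + y) / T\<^sup>2 \<le> 6 * y * (3 * A + y) / (T * (T - 1))"
    using T A y by (intro divide_left_mono) (auto simp: power2_eq_square intro!: mult_pos_pos mult_left_mono)
  also have "\<dots> = 6 * y * (A - real k + y) / (T - 1) - 6 * y * (A - n + y) / T"
  proof -
    have "6 * y * (A - real k + y) * T - 6 * y * (A - n + y) * (T - 1) = 6 * y * (3 * A + y)"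
      unfolding T_def n_def by algebra
    then show ?thesis using T by (simp add: diff_frac_eq mult.commute)
  qed
  finally have "- (6 * y * (A - real k + y) / (T - 1)) \<le> - (6 * y * (A - n + y) / T) + - (6 * y * (3 * A + y) / T\<^sup>2)"
    by linarith
  then have "exp (- (6 * y * (A - real k + y) / (T - 1))) \<le> exp (- (6 * y * (A - n + y) / T)) * exp (- (6 * y * (3 * A + y) / T\<^sup>2))"
    unfolding exp_add[symmetric] by simp
  moreover have "crossing_weight y k A = exp (- (6 * y * (A - real k + y) / (T - 1)))"
    unfolding crossing_weight_def T_def n_def by (simp add: algebra_simps)
  moreover have W_eq: "W = exp (- (6 * y * (A - n + y) / T))"
    unfolding W_def crossing_weight_def T_def n_def by (simp add: algebra_simps)
  ultimately have "crossing_weight y k A \<le> W * exp (- (6 * y * (3 * A + y) / T\<^sup>2))" by simp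
  also have "\<dots> \<le> W * (1 - 6 * y * A * (3 * n - 2 * y) / (n * T\<^sup>2))"
    using d W by (intro mult_left_mono) auto
  finally have "n * A ^ k * crossing_weight y k A \<le> n * A ^ k * (W * (1 - 6 * y * A * (3 * n - 2 * y) / (n * T\<^sup>2)))"
    using n A by (intro mult_left_mono) auto
  also have "\<dots> = n * A ^ k * W - A ^ Suc k * (W * (6 * y * (3 * n - 2 * y) / T\<^sup>2))"
    using n T by (simp add: field_simps)
  finally show ?thesis unfolding W_def T_def n_def .
qed

section \<open>Crossing events and the volume recursion\<close>

text \<open>The existence of a real \<open>a\<close> such that more than \<open>a + y\<close> of the points lie in \<open>[0, a]\<close>, rephrased as an
  existential over finitely many sets of indices so that measurability is immediate.\<close>

definition crossing :: "'i set \<Rightarrow> real \<Rightarrow> ('i \<Rightarrow> real) \<Rightarrow> bool" where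
  "crossing I y w \<longleftrightarrow> (\<exists>S\<subseteq>I. S \<noteq> {} \<and> (\<forall>i\<in>S. w i < real (card S) - y))"

lemma crossing_restrict_iff: "I \<subseteq> J \<Longrightarrow> crossing I y (restrict w J) \<longleftrightarrow> crossing I y w"
  unfolding crossing_def by (intro ex_cong1) (auto simp: subset_iff)

lemma pred_crossing[measurable]:
  assumes I: "finite I" "I \<subseteq> J" and M: "\<And>i. i \<in> I \<Longrightarrow> sets (M i) = sets borel"
  shows "Measurable.pred (PiM J M) (crossing I y)"
proof -
  have "Measurable.pred (PiM J M) (\<lambda>w. w i < c)" if "i \<in> I" for i c
  proof -
    have "(\<lambda>w. w i) \<in> borel_measurable (PiM J M)"
      using measurable_component_singleton[of i J M] that I M[OF that] by (auto cong: measurable_cong_sets)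
    then show ?thesis by measurable
  qed
  then have "Measurable.pred (PiM J M) (\<lambda>w. \<exists>S\<in>Pow I - {{}}. \<forall>i\<in>S. w i < real (card S) - y)"
    using I by (intro pred_intros_finite) (auto intro: finite_subset)
  moreover have "crossing I y = (\<lambda>w. \<exists>S\<in>Pow I - {{}}. \<forall>i\<in>S. w i < real (card S) - y)"
    unfolding crossing_def by auto
  ultimately show ?thesis by simp
qed

text \<open>Split according to the largest coordinate \<open>w i\<close>. If it is at most |I| - y,
  all coordinates are. Otherwise \<open>i\<close> lies outside the witnessing set S, whose
  coordinates are below card S - y and hence below |I| - y, so the remaining points already
  cross.\<close>

lemma crossing_cases:
  assumes "finite I" and w: "w \<in> Pi I (\<lambda>_. {0..A})" and "crossing I y w"
  obtains "w \<in> Pi I (\<lambda>_. {0..real (card I) - y})"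
  | i where "i \<in> I" "real (card I) - y < w i" "w i \<le> A" "crossing (I - {i}) y w" "w \<in> Pi (I - {i}) (\<lambda>_. {0..w i})"
proof -
  obtain S where S: "S \<subseteq> I" "S \<noteq> {}" "\<And>i. i \<in> S \<Longrightarrow> w i < real (card S) - y"
    using assms(3) unfolding crossing_def by blast
  have fin: "finite (w ` I)" "w ` I \<noteq> {}" using assms(1) S by auto
  obtain i where i: "i \<in> I" "w i = Max (w ` I)" using Max_in[OF fin] by auto
  have max: "w j \<le> w i" if "j \<in> I" for j using that fin i by auto
  have card: "real (card S) \<le> real (card I)" using S assms(1) by (auto intro: card_mono)
  show thesis
  proof (cases "w i \<le> real (card I) - y")
    case True
    then show thesis using max w by (intro that(1)) (force simp: Pi_iff)
  next
    case False
    then have "i \<notin> S" using S(3)[of i] card by auto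
    then have "crossing (I - {i}) y w" unfolding crossing_def using S by blast
    then show thesis using False i w max by (intro that(2)[of i]) (auto simp: Pi_iff)
  qed
qed

text \<open>Volumes are normalised so that the uniform law on [0, N] stays fixed while A varies. The
  induction removes the largest point; the case of no points is excluded by 0 < y < card I.\<close>

lemma emeasure_crossing_le:
  fixes N y :: real and I :: "'i set"
  assumes N: "0 < N" and y: "0 < y"
  defines "U \<equiv> uniform_measure lborel {0..N}"
  shows "finite I \<Longrightarrow> y < real (card I) \<Longrightarrow> real (card I) - y \<le> A \<Longrightarrow> A \<le> N \<Longrightarrow>
    emeasure (PiM I (\<lambda>_. U)) {w \<in> space (PiM I (\<lambda>_. U)). w \<in> Pi I (\<lambda>_. {0..A}) \<and> crossing I y w}
      \<le> ennreal ((A / N) ^ card I * crossing_weight y (card I) A)"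
proof (induction "card I" arbitrary: I A)
  case 0
  then show ?case using y by auto
next
  case (Suc k)
  have prU: "prob_space U" unfolding U_def using N by (intro prob_space_uniform_measure) auto
  interpret U: prob_space U by (rule prU)
  interpret P: product_sigma_finite "\<lambda>_. U" by standard
  have [simp, measurable_cong]: "sets U = sets borel" and spU[simp]: "space U = UNIV" unfolding U_def by auto
  have emU: "emeasure U {0..a} = ennreal (a / N)" if "0 \<le> a" "a \<le> N" for a
  proof -
    have "{0..N} \<inter> {0..a} = {0..a}" using that by auto
    then show ?thesis unfolding U_def using that N
      by (subst emeasure_uniform_measure) (auto simp: divide_ennreal)
  qed
  define n where "n = real (card I)"
  have n: "n = 1 + real k" unfolding n_def using Suc(2) by simp
  define C where "C J a = {w \<in> space (PiM J (\<lambda>_. U)). w \<in> Pi J (\<lambda>_. {0..a}) \<and> crossing J y w}" for J :: "'i set" and a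
  have A: "n - y \<le> A" "A \<le> N" "0 < n - y" using Suc unfolding n_def by auto
  have fin: "finite I" by fact
  \<comment> \<open>Coordinate \<open>i\<close> is the largest, exceeds n - y, and the others cross
    without it. Ties may make these events overlap, but only a union bound is taken.\<close>
  define D where "D i = {w \<in> space (PiM I (\<lambda>_. U)). n - y < w i \<and> w i \<le> A \<and> crossing (I - {i}) y w \<and> w \<in> Pi (I - {i}) (\<lambda>_. {0..w i})}" for i
  have comp[measurable]: "(\<lambda>w. w i) \<in> borel_measurable (PiM I (\<lambda>_. U))" if "i \<in> I" for i
    using measurable_component_singleton[of i I "\<lambda>_. U"] that by simp
  have D_meas: "D i \<in> sets (PiM I (\<lambda>_. U))" if i: "i \<in> I" for i
  proof -
    have [measurable]: "Measurable.pred (PiM I (\<lambda>_. U)) (crossing (I - {i}) y)"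
      using fin by (intro pred_crossing) auto
    have "Measurable.pred (PiM I (\<lambda>_. U)) (\<lambda>w. \<forall>j\<in>I-{i}. 0 \<le> w j \<and> w j \<le> w i)"
    proof (intro pred_intros_finite)
      fix j assume "j \<in> I - {i}"
      then have j: "j \<in> I" by auto
      show "Measurable.pred (PiM I (\<lambda>_. U)) (\<lambda>w. 0 \<le> w j \<and> w j \<le> w i)"
        using borel_measurable_le[OF borel_measurable_const comp[OF j], of 0]
          borel_measurable_le[OF comp[OF j] comp[OF i]]
        unfolding pred_def by (auto intro: sets.sets_Collect_conj)
    qed (use fin in auto)
    then have [measurable]: "Measurable.pred (PiM I (\<lambda>_. U)) (\<lambda>w. w \<in> Pi (I-{i}) (\<lambda>_. {0..w i}))"
      by (simp add: Pi_iff Ball_def)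
    show ?thesis unfolding D_def using i by measurable
  qed
  define Q where "Q = Pi\<^sub>E I (\<lambda>_. {0..n - y})"
  have Q_meas: "Q \<in> sets (PiM I (\<lambda>_. U))"
    unfolding Q_def using fin by (intro sets_PiM_I_finite) auto
  have UN_meas: "(\<Union>i\<in>I. D i) \<in> sets (PiM I (\<lambda>_. U))"
    using fin D_meas by (intro sets.finite_UN) auto
  have emQ: "emeasure (PiM I (\<lambda>_. U)) Q = ennreal (((n - y) / N) ^ Suc k)"
    unfolding Q_def using fin A Suc(2) N emU[of "n - y"]
    by (subst P.emeasure_PiM) (auto simp: ennreal_power)
  have "C I A \<subseteq> Q \<union> (\<Union>i\<in>I. D i)"
  proof
    fix w assume "w \<in> C I A"
    then have w: "w \<in> space (PiM I (\<lambda>_. U))" "w \<in> Pi I (\<lambda>_. {0..A})" "crossing I y w" unfolding C_def by auto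
    from crossing_cases[OF fin w(2,3)] show "w \<in> Q \<union> (\<Union>i\<in>I. D i)"
      by cases (use w(1) in \<open>auto simp: Q_def D_def n_def space_PiM PiE_def\<close>)
  qed
  then have "emeasure (PiM I (\<lambda>_. U)) (C I A) \<le> emeasure (PiM I (\<lambda>_. U)) (Q \<union> (\<Union>i\<in>I. D i))"
    using Q_meas UN_meas by (intro emeasure_mono sets.Un)
  also have "\<dots> \<le> emeasure (PiM I (\<lambda>_. U)) Q + (\<Sum>i\<in>I. emeasure (PiM I (\<lambda>_. U)) (D i))"
    using D_meas fin
    by (intro order.trans[OF emeasure_subadditive[OF Q_meas UN_meas]] add_left_mono emeasure_subadditive_finite) auto
  also have "(\<Sum>i\<in>I. emeasure (PiM I (\<lambda>_. U)) (D i)) \<le> (\<Sum>i\<in>I. \<integral>\<^sup>+s. ennreal (s ^ k * crossing_weight y k s / N ^ Suc k) * indicator {n - y..A} s \<partial>lborel)"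
  proof (rule sum_mono)
    fix i assume i: "i \<in> I"
    define J where "J = I - {i}"
    have J: "finite J" "i \<notin> J" "insert i J = I" "card J = k" unfolding J_def using fin i Suc(2) by auto
    have "emeasure (PiM I (\<lambda>_. U)) (D i) = (\<integral>\<^sup>+w. indicator (D i) w \<partial>PiM (insert i J) (\<lambda>_. U))"
      using D_meas[OF i] J by simp
    \<comment> \<open>Fubini with the largest coordinate s outermost: the section at s is the
      crossing event \<open>C J s\<close> of the other k points in [0, s].\<close>
    also have "\<dots> = (\<integral>\<^sup>+s. \<integral>\<^sup>+x. indicator (D i) (x(i := s)) \<partial>PiM J (\<lambda>_. U) \<partial>U)"
      using J D_meas[OF i] by (intro P.product_nn_integral_insert_rev) auto
    also have "\<dots> \<le> (\<integral>\<^sup>+s. ennreal ((s / N) ^ k * crossing_weight y k s) * indicator {n - y..A} s \<partial>U)"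
    proof (rule nn_integral_mono)
      fix s
      show "(\<integral>\<^sup>+x. indicator (D i) (x(i := s)) \<partial>PiM J (\<lambda>_. U)) \<le> ennreal ((s / N) ^ k * crossing_weight y k s) * indicator {n - y..A} s"
      proof (cases "n - y < s \<and> s \<le> A")
        case False
        then have "(\<integral>\<^sup>+x. indicator (D i) (x(i := s)) \<partial>PiM J (\<lambda>_. U)) = (\<integral>\<^sup>+x. 0 \<partial>PiM J (\<lambda>_. U))"
          by (intro nn_integral_cong) (auto simp: D_def indicator_def)
        then show ?thesis by simp
      next
        case s: True
        have CJ: "C J s \<in> sets (PiM J (\<lambda>_. U))"
        proof -
          have "C J s = Pi\<^sub>E J (\<lambda>_. {0..s}) \<inter> {w \<in> space (PiM J (\<lambda>_. U)). crossing J y w}"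
            unfolding C_def by (auto simp: space_PiM PiE_def)
          moreover have "Measurable.pred (PiM J (\<lambda>_. U)) (crossing J y)"
            using J by (intro pred_crossing) auto
          ultimately show ?thesis using J by (auto intro!: sets.Int sets_PiM_I_finite simp: pred_def)
        qed
        have cong: "crossing J y (x(i := s)) \<longleftrightarrow> crossing J y x" for x
          unfolding crossing_def using J(2) by (intro ex_cong1) (auto simp: subset_iff)
        have "(\<integral>\<^sup>+x. indicator (D i) (x(i := s)) \<partial>PiM J (\<lambda>_. U)) = (\<integral>\<^sup>+x. indicator (C J s) x \<partial>PiM J (\<lambda>_. U))"
        proof (intro nn_integral_cong)
          fix x assume x: "x \<in> space (PiM J (\<lambda>_. U))"
          have "x(i := s) \<in> space (PiM I (\<lambda>_. U))"
            using x J by (auto simp: space_PiM PiE_def extensional_def)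
          moreover have "x(i := s) \<in> Pi J (\<lambda>_. {0..s}) \<longleftrightarrow> x \<in> Pi J (\<lambda>_. {0..s})"
            using J(2) by (auto simp: Pi_iff)
          ultimately show "indicator (D i) (x(i := s)) = (indicator (C J s) x :: ennreal)"
            using s x cong[of x] unfolding D_def C_def J_def[symmetric] by (auto simp: indicator_def)
        qed
        also have "\<dots> = emeasure (PiM J (\<lambda>_. U)) (C J s)" using CJ by simp
        also have "\<dots> \<le> ennreal ((s / N) ^ k * crossing_weight y k s)"
        proof (cases "y < real k")
          case True
          have "real (card J) - y \<le> s" using s n J by simp
          then show ?thesis using Suc(1)[of J s] J True s A unfolding C_def by simp
        next
          \<comment> \<open>The induction hypothesis does not cover y at least k, but then a
            crossing of k points in [0, s] would force a coordinate below card S - y, which is at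
            most 0.\<close>
          case False
          have "C J s = {}"
          proof (rule ccontr)
            assume "C J s \<noteq> {}"
            then obtain w S where w: "w \<in> Pi J (\<lambda>_. {0..s})" "S \<subseteq> J" "S \<noteq> {}" "\<forall>i\<in>S. w i < real (card S) - y"
              unfolding C_def crossing_def by blast
            then obtain j where j: "j \<in> S" "0 \<le> w j" "w j < real (card S) - y" by (auto simp: Pi_iff)
            moreover have "real (card S) \<le> real k" using w J card_mono[of J S] by simp
            ultimately show False using False by linarith
          qed
          then show ?thesis by simp
        qed
        finally show ?thesis using s by simp
      qed
    qed
    also have "\<dots> = (\<integral>\<^sup>+s. ennreal ((s / N) ^ k * crossing_weight y k s) * indicator {n - y..A} s * indicator {0..N} s \<partial>lborel) / emeasure lborel {0..N}"
      unfolding U_def by (subst nn_integral_uniform_measure) (auto simp: crossing_weight_def)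
    also have "\<dots> = (\<integral>\<^sup>+s. ennreal ((s / N) ^ k * crossing_weight y k s) * indicator {n - y..A} s \<partial>lborel) / ennreal N"
      using N A by (intro arg_cong2[where f = "(/)"] nn_integral_cong) (auto simp: indicator_def)
    also have "\<dots> = (\<integral>\<^sup>+s. ennreal (s ^ k * crossing_weight y k s / N ^ Suc k) * indicator {n - y..A} s \<partial>lborel)"
    proof -
      have "ennreal ((s / N) ^ k * crossing_weight y k s) * indicator {n - y..A} s / ennreal N
         = ennreal (s ^ k * crossing_weight y k s / N ^ Suc k) * indicator {n - y..A} s" for s
        using N A crossing_weight_pos[of y k s]
        by (auto simp: indicator_def divide_ennreal power_divide field_simps)
      moreover have "(\<integral>\<^sup>+s. ennreal ((s / N) ^ k * crossing_weight y k s) * indicator {n - y..A} s \<partial>lborel) / ennreal N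
        = (\<integral>\<^sup>+s. ennreal ((s / N) ^ k * crossing_weight y k s) * indicator {n - y..A} s / ennreal N \<partial>lborel)"
        by (subst nn_integral_divide) (auto simp: crossing_weight_def)
      ultimately show ?thesis by simp
    qed
    finally show "emeasure (PiM I (\<lambda>_. U)) (D i) \<le> (\<integral>\<^sup>+s. ennreal (s ^ k * crossing_weight y k s / N ^ Suc k) * indicator {n - y..A} s \<partial>lborel)" .
  qed
  also have "\<dots> = of_nat (Suc k) * (\<integral>\<^sup>+s. ennreal (s ^ k * crossing_weight y k s / N ^ Suc k) * indicator {n - y..A} s \<partial>lborel)"
    using Suc(2) by simp
  finally have bound: "emeasure (PiM I (\<lambda>_. U)) (C I A) \<le> ennreal (((n - y) / N) ^ Suc k)
      + of_nat (Suc k) * (\<integral>\<^sup>+s. ennreal (s ^ k * crossing_weight y k s / N ^ Suc k) * indicator {n - y..A} s \<partial>lborel)"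
    unfolding emQ by (simp add: add_left_mono)
  \<comment> \<open>\<open>G\<close> is the normalised supersolution and \<open>g\<close> its
    derivative. Since \<open>g\<close> dominates the integrand of the recursion, the fundamental
    theorem bounds the integral by G A - G (n - y).\<close>
  define G where "G = (\<lambda>s. s ^ Suc k * crossing_weight y (Suc k) s / N ^ Suc k)"
  define g where "g = (\<lambda>s. (n * s ^ k * crossing_weight y (Suc k) s
     - s ^ Suc k * (crossing_weight y (Suc k) s * (6 * y * (3 * n - 2 * y) / (n + 2 * s)\<^sup>2))) / N ^ Suc k)"
  have g_ge: "n * (s ^ k * crossing_weight y k s / N ^ Suc k) \<le> g s" if "n - y \<le> s" for s
    using crossing_weight_step[of s y k] that A y n N unfolding g_def
    by (simp add: divide_right_mono)
  have g_nonneg: "0 \<le> g s" if "n - y \<le> s" for s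
  proof -
    have "0 \<le> n * (s ^ k * crossing_weight y k s / N ^ Suc k)"
      using crossing_weight_pos[of y k s] that A N n by (intro mult_nonneg_nonneg divide_nonneg_nonneg) auto
    then show ?thesis using g_ge[OF that] by linarith
  qed
  have G: "(G has_real_derivative g s) (at s)" if "n - y \<le> s" for s
  proof -
    have "0 < s" using that A by auto
    from DERIV_cdivide[OF has_derivative_crossing_weight[OF this, of "Suc k" y], of "N ^ Suc k"]
    show ?thesis unfolding G_def g_def n by simp
  qed
  have "of_nat (Suc k) * (\<integral>\<^sup>+s. ennreal (s ^ k * crossing_weight y k s / N ^ Suc k) * indicator {n - y..A} s \<partial>lborel)
     = (\<integral>\<^sup>+s. of_nat (Suc k) * (ennreal (s ^ k * crossing_weight y k s / N ^ Suc k) * indicator {n - y..A} s) \<partial>lborel)"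
    by (subst nn_integral_cmult) (auto simp: crossing_weight_def)
  also have "\<dots> \<le> (\<integral>\<^sup>+s. ennreal (g s) * indicator {n - y..A} s \<partial>lborel)"
  proof (rule nn_integral_mono)
    fix s
    have "of_nat (Suc k) = ennreal n" using n by (simp add: ennreal_of_nat_eq_real_of_nat)
    moreover have "0 \<le> n" using n by simp
    ultimately show "of_nat (Suc k) * (ennreal (s ^ k * crossing_weight y k s / N ^ Suc k) * indicator {n - y..A} s) \<le> ennreal (g s) * indicator {n - y..A} s"
      using g_ge[of s] by (auto simp: indicator_def ennreal_mult'[symmetric] intro!: ennreal_leI)
  qed
  also have "\<dots> = ennreal (G A - G (n - y))"
    using A G g_nonneg
    by (intro nn_integral_FTC_Icc) (auto simp: g_def crossing_weight_def intro: has_field_derivative_at_within)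
  finally have "emeasure (PiM I (\<lambda>_. U)) (C I A) \<le> ennreal (((n - y) / N) ^ Suc k) + ennreal (G A - G (n - y))"
    using bound by (meson add_left_mono order.trans)
  \<comment> \<open>The weight is 1 at n - y, so the term for all points in [0, n - y] is exactly
    the lower boundary value of \<open>G\<close> and cancels.\<close>
  also have "((n - y) / N) ^ Suc k = G (n - y)"
  proof -
    have "crossing_weight y (Suc k) (n - y) = 1" unfolding crossing_weight_def n by simp
    then show ?thesis unfolding G_def by (simp only: power_divide mult_1_right)
  qed
  also have "ennreal (G (n - y)) + ennreal (G A - G (n - y)) = ennreal (G A)"
  proof -
    have "G (n - y) \<le> G A" 
    proof (rule DERIV_nonneg_imp_nondecreasing[where f = G])
      show "\<exists>d. (G has_real_derivative d) (at s) \<and> 0 \<le> d" if "n - y \<le> s" "s \<le> A" for s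
        using G[OF that(1)] g_nonneg[OF that(1)] by blast
    qed (use A in auto)
    moreover have "0 \<le> G (n - y)" unfolding G_def
      using A N less_imp_le[OF crossing_weight_pos[of y "Suc k" "n - y"]]
      by (intro divide_nonneg_nonneg mult_nonneg_nonneg zero_le_power) auto
    ultimately show ?thesis by (subst ennreal_plus[symmetric]) auto
  qed
  also have "G A = (A / N) ^ card I * crossing_weight y (card I) A"
    unfolding G_def Suc(2)[symmetric] power_divide by simp
  finally show ?case unfolding C_def .
qed

section \<open>The one-sample inequality\<close>

lemma ex_cdf_eq:
  assumes "real_distribution P" "continuous_on UNIV (cdf P)" "0 < t" "t < 1"
  shows "\<exists>c. cdf P c = t"
proof -
  interpret real_distribution P by fact
  obtain a where a: "cdf P a < t"
    using order_tendstoD(2)[OF cdf_lim_at_bot \<open>0 < t\<close>] unfolding eventually_at_bot_linorder by auto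
  obtain b where b: "t < cdf P b"
    using order_tendstoD(1)[OF cdf_lim_at_top_prob \<open>t < 1\<close>] unfolding eventually_at_top_linorder by auto
  have "a \<le> b" using a b cdf_nondecreasing[of b a] by linarith
  then have "\<exists>c\<ge>a. c \<le> b \<and> cdf P c = t"
    using a b assms(2) by (intro IVT') (auto intro: continuous_on_subset)
  then show ?thesis by auto
qed

context prob_space
begin

text \<open>F may be constant on intervals, so there is no inverse to apply. Instead each s in (t,
  1) is attained at some c by continuity, {F(X) \<le> t} lies in {X \<le> c}, and s decreases to
  t.\<close>

lemma prob_cdf_le:
  assumes X[measurable]: "random_variable borel X" and F: "cdf (distr M borel X) = F" "continuous_on UNIV F"
    and t: "0 \<le> t" "t < 1"
  shows "prob {\<omega>\<in>space M. F (X \<omega>) \<le> t} \<le> t"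
proof (rule dense_ge_bounded[OF t(2)])
  interpret X: real_distribution "distr M borel X" by (rule real_distribution_distr) fact
  fix s assume s: "t < s" "s < 1"
  then obtain c where c: "F c = s" using ex_cdf_eq[of "distr M borel X" s] F X.real_distribution_axioms t by auto
  have "prob {\<omega>\<in>space M. F (X \<omega>) \<le> t} \<le> prob {\<omega>\<in>space M. X \<omega> \<le> c}"
  proof (rule finite_measure_mono)
    show "{\<omega>\<in>space M. F (X \<omega>) \<le> t} \<subseteq> {\<omega>\<in>space M. X \<omega> \<le> c}"
    proof safe
      fix \<omega> assume "F (X \<omega>) \<le> t"
      then have "\<not> F c \<le> F (X \<omega>)" using c s by linarith
      then show "X \<omega> \<le> c" using X.cdf_nondecreasing[of c "X \<omega>"] unfolding F(1) by linarith
    qed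
  qed measurable
  also have "\<dots> = F c" unfolding F(1)[symmetric] cdf_def
    by (subst measure_distr) (auto intro!: arg_cong[where f = prob])
  finally show "prob {\<omega>\<in>space M. F (X \<omega>) \<le> t} \<le> s" using c by simp
qed

text \<open>Approximation from below. The strict inequality here and the weak one in
  \<open>prob_cdf_le\<close> together determine both P(F(X) < t) and P(F(X) \<le> t); the strict
  version yields the law of 1 - F(X).\<close>

lemma le_prob_cdf_less:
  assumes X[measurable]: "random_variable borel X" and F: "cdf (distr M borel X) = F" "continuous_on UNIV F"
    and t: "t \<le> 1"
  shows "t \<le> prob {\<omega>\<in>space M. F (X \<omega>) < t}"
proof (cases "0 < t")
  case True
  interpret X: real_distribution "distr M borel X" by (rule real_distribution_distr) fact
  have [measurable]: "F \<in> borel_measurable borel" by (rule borel_measurable_continuous_onI) fact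
  show ?thesis
  proof (rule dense_le_bounded[OF True])
    fix s assume s: "0 < s" "s < t"
    then obtain c where c: "F c = s" using ex_cdf_eq[of "distr M borel X" s] F X.real_distribution_axioms t by auto
    have "F c = prob {\<omega>\<in>space M. X \<omega> \<le> c}" unfolding F(1)[symmetric] cdf_def
      by (subst measure_distr) (auto intro!: arg_cong[where f = prob])
    also have "\<dots> \<le> prob {\<omega>\<in>space M. F (X \<omega>) < t}"
    proof (rule finite_measure_mono)
      show "{\<omega>\<in>space M. X \<omega> \<le> c} \<subseteq> {\<omega>\<in>space M. F (X \<omega>) < t}"
        using c s X.cdf_nondecreasing[of _ c] unfolding F(1) by force
    qed measurable
    finally show "s \<le> prob {\<omega>\<in>space M. F (X \<omega>) < t}" using c by simp
  qed
next
  case False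
  then show ?thesis using order.trans[of t 0, OF _ measure_nonneg] by simp
qed

lemma distr_eq_uniform_measureI:
  assumes W[measurable]: "random_variable borel W" and range: "\<And>\<omega>. \<omega> \<in> space M \<Longrightarrow> W \<omega> \<in> {0..N}"
    and N: "0 < N" and cdf: "\<And>t. 0 \<le> t \<Longrightarrow> t < N \<Longrightarrow> prob {\<omega>\<in>space M. W \<omega> \<le> t} = t / N"
  shows "distr M borel W = uniform_measure lborel {0..N}"
proof (rule cdf_unique)
  have em: "emeasure lborel {0..N} \<noteq> 0" "emeasure lborel {0..N} \<noteq> \<infinity>" using N by auto
  interpret U: prob_space "uniform_measure lborel {0..N}" using em by (rule prob_space_uniform_measure)
  show "real_distribution (distr M borel W)" by (rule real_distribution_distr) fact
  show "real_distribution (uniform_measure lborel {0..N})" by unfold_locales auto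
  show "cdf (distr M borel W) = cdf (uniform_measure lborel {0..N})"
  proof
    fix t
    have cdf_W: "cdf (distr M borel W) t = prob {\<omega>\<in>space M. W \<omega> \<le> t}"
      unfolding cdf_def by (subst measure_distr) (auto intro!: arg_cong[where f = prob])
    have cdf_U: "cdf (uniform_measure lborel {0..N}) t = measure lborel ({0..N} \<inter> {..t}) / N"
      unfolding cdf_def using N em by (subst measure_uniform_measure) auto
    consider "t < 0" | "0 \<le> t" "t < N" | "N \<le> t" by linarith
    then show "cdf (distr M borel W) t = cdf (uniform_measure lborel {0..N}) t"
    proof cases
      case 1
      then have empty: "{\<omega>\<in>space M. W \<omega> \<le> t} = {}" "{0..N} \<inter> {..t} = {}" using range by force+
      show ?thesis unfolding cdf_W cdf_U empty by simp
    next
      case 2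
      then have "{0..N} \<inter> {..t} = {0..t}" by auto
      then show ?thesis unfolding cdf_W cdf_U using 2 cdf[OF 2] by simp
    next
      case 3
      then have full: "{\<omega>\<in>space M. W \<omega> \<le> t} = space M" "{0..N} \<inter> {..t} = {0..N}" using range by force+
      show ?thesis unfolding cdf_W cdf_U full using N by (simp add: prob_space)
    qed
  qed
qed

text \<open>The two transforms serve the two one-sided deviations of the empirical distribution
  function. The scale N will be the sample size, so that the points have unit density on
  [0, n].\<close>

lemma
  assumes X[measurable]: "random_variable borel X" and F: "cdf (distr M borel X) = F" "continuous_on UNIV F"
    and N: "0 < N"
  shows distr_cdf_eq_uniform: "distr M borel (\<lambda>\<omega>. N * F (X \<omega>)) = uniform_measure lborel {0..N}"
    and distr_1_minus_cdf_eq_uniform: "distr M borel (\<lambda>\<omega>. N * (1 - F (X \<omega>))) = uniform_measure lborel {0..N}"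
proof -
  interpret X: real_distribution "distr M borel X" by (rule real_distribution_distr) fact
  have [measurable]: "F \<in> borel_measurable borel" by (rule borel_measurable_continuous_onI) fact
  have F01: "0 \<le> F x" "F x \<le> 1" for x
    using X.cdf_nonneg[of x] X.cdf_bounded_prob[of x] unfolding F(1) by auto
  have le: "prob {\<omega>\<in>space M. F (X \<omega>) < t} \<le> prob {\<omega>\<in>space M. F (X \<omega>) \<le> t}" for t
    by (rule finite_measure_mono) auto
  have eq_le: "prob {\<omega>\<in>space M. F (X \<omega>) \<le> t} = t" if "0 \<le> t" "t < 1" for t
    using prob_cdf_le[OF X F that] le_prob_cdf_less[OF X F, of t] le[of t] that by linarith
  have eq_less: "prob {\<omega>\<in>space M. F (X \<omega>) < t} = t" if "0 < t" "t \<le> 1" for t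
  proof (cases "t = 1")
    case True
    then show ?thesis using le_prob_cdf_less[OF X F, of t] by (intro antisym) auto
  next
    case False
    then show ?thesis using prob_cdf_le[OF X F, of t] le_prob_cdf_less[OF X F, of t] le[of t] that by simp
  qed
  show "distr M borel (\<lambda>\<omega>. N * F (X \<omega>)) = uniform_measure lborel {0..N}"
  proof (rule distr_eq_uniform_measureI)
    fix t assume t: "0 \<le> t" "t < N"
    have "{\<omega>\<in>space M. N * F (X \<omega>) \<le> t} = {\<omega>\<in>space M. F (X \<omega>) \<le> t / N}"
      using N by (auto simp: field_simps)
    then show "prob {\<omega>\<in>space M. N * F (X \<omega>) \<le> t} = t / N" using eq_le[of "t / N"] t N by simp
  qed (use N F01 in \<open>auto simp: mult_left_le\<close>)
  show "distr M borel (\<lambda>\<omega>. N * (1 - F (X \<omega>))) = uniform_measure lborel {0..N}"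
  proof (rule distr_eq_uniform_measureI)
    fix t assume t: "0 \<le> t" "t < N"
    have "{\<omega>\<in>space M. N * (1 - F (X \<omega>)) \<le> t} = space M - {\<omega>\<in>space M. F (X \<omega>) < 1 - t / N}"
      using N by (auto simp: field_simps)
    then show "prob {\<omega>\<in>space M. N * (1 - F (X \<omega>)) \<le> t} = t / N"
      using eq_less[of "1 - t / N"] t N by (simp add: prob_compl)
  qed (use N F01 in \<open>auto simp: mult_left_le\<close>)
qed

text \<open>This is \<open>emeasure_crossing_le\<close> at A = N = n, where the exponent 6y^2/(3n)
  becomes 2y^2/n. For y at least n nonnegative points cannot cross.\<close>

lemma prob_crossing_le:
  assumes I: "finite I" "card I = n" "0 < n" and W: "indep_vars (\<lambda>_. borel) W I"
    and U: "\<And>i. i \<in> I \<Longrightarrow> distr M borel (W i) = uniform_measure lborel {0..real n}"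
    and range: "\<And>i \<omega>. i \<in> I \<Longrightarrow> \<omega> \<in> space M \<Longrightarrow> W i \<omega> \<in> {0..real n}" and y: "0 < y"
  shows "prob {\<omega>\<in>space M. crossing I y (\<lambda>i. W i \<omega>)} \<le> exp (- (2 * y\<^sup>2 / real n))"
proof (cases "y < real n")
  case False
  have empty: "{\<omega>\<in>space M. crossing I y (\<lambda>i. W i \<omega>)} = {}"
  proof (rule ccontr)
    assume "\<not> ?thesis"
    then obtain \<omega> S where \<omega>: "\<omega> \<in> space M" "S \<subseteq> I" "S \<noteq> {}" "\<forall>i\<in>S. W i \<omega> < real (card S) - y"
      unfolding crossing_def by blast
    then obtain j where "j \<in> S" "j \<in> I" "W j \<omega> < real (card S) - y" by auto
    moreover have "real (card S) \<le> real n" using \<omega> I card_mono[of I S] by simp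
    ultimately show False using False range[of j \<omega>] \<omega> by auto
  qed
  show ?thesis unfolding empty by simp
next
  case True
  define U where "U = uniform_measure lborel {0..real n}"
  have rv: "random_variable borel (W i)" if "i \<in> I" for i using W that unfolding indep_vars_def by auto
  have ne: "I \<noteq> {}" using I by auto
  have P: "distr M (PiM I (\<lambda>_. borel)) (\<lambda>\<omega>. \<lambda>i\<in>I. W i \<omega>) = PiM I (\<lambda>_. U)"
    using W indep_vars_iff_distr_eq_PiM'[OF ne rv] assms(5) unfolding U_def by (auto cong: PiM_cong)
  define C where "C = {w \<in> space (PiM I (\<lambda>_. borel)). w \<in> Pi I (\<lambda>_. {0..real n}) \<and> crossing I y w}"
  have C: "C \<in> sets (PiM I (\<lambda>_. borel))"
  proof -
    have "C = Pi\<^sub>E I (\<lambda>_. {0..real n}) \<inter> {w \<in> space (PiM I (\<lambda>_. borel)). crossing I y w}"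
      unfolding C_def by (auto simp: space_PiM PiE_def)
    moreover have "Measurable.pred (PiM I (\<lambda>_. borel :: real measure)) (crossing I y)"
      using I by (intro pred_crossing) auto
    ultimately show ?thesis using I by (auto intro!: sets.Int sets_PiM_I_finite simp: pred_def)
  qed
  have m: "(\<lambda>\<omega>. \<lambda>i\<in>I. W i \<omega>) \<in> measurable M (PiM I (\<lambda>_. borel))"
    using rv by (intro measurable_restrict) auto
  have "emeasure M {\<omega>\<in>space M. crossing I y (\<lambda>i. W i \<omega>)} = emeasure M ((\<lambda>\<omega>. \<lambda>i\<in>I. W i \<omega>) -` C \<inter> space M)"
    using range by (intro arg_cong[where f = "emeasure M"])
      (auto simp: C_def space_PiM crossing_restrict_iff Pi_iff)
  also have "\<dots> = emeasure (PiM I (\<lambda>_. U)) C"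
    unfolding P[symmetric] using m C by (subst emeasure_distr) auto
  also have "C = {w \<in> space (PiM I (\<lambda>_. U)). w \<in> Pi I (\<lambda>_. {0..real n}) \<and> crossing I y w}"
    unfolding C_def U_def by (auto simp: space_PiM)
  also have "emeasure (PiM I (\<lambda>_. U)) \<dots> \<le> ennreal ((real n / real n) ^ card I * crossing_weight y (card I) (real n))"
    unfolding U_def using I y True by (intro emeasure_crossing_le) auto
  also have "(real n / real n) ^ card I * crossing_weight y (card I) (real n) = exp (- (2 * y\<^sup>2 / real n))"
    using I unfolding crossing_weight_def by (simp add: power2_eq_square field_simps)
  finally show ?thesis unfolding emeasure_eq_measure by simp
qed

end

section \<open>From empirical deviations to crossings\<close>

lemma ecdf_bounds: "0 \<le> ecdf n x t" "ecdf n x t \<le> 1"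
proof -
  have "(\<Sum>i=1..n. indicator {..t} (x i)) \<le> (\<Sum>i=1..n. 1 :: real)" by (intro sum_mono) (simp add: indicator_def)
  then show "ecdf n x t \<le> 1" unfolding ecdf_def by (cases "n = 0") (auto simp: field_simps)
  show "0 \<le> ecdf n x t" unfolding ecdf_def by (intro mult_nonneg_nonneg sum_nonneg) auto
qed

lemma bdd_above_abs_diff:
  fixes A B :: "'b \<Rightarrow> real"
  assumes "\<And>x. 0 \<le> A x" "\<And>x. A x \<le> 1" "\<And>x. 0 \<le> B x" "\<And>x. B x \<le> 1"
  shows "bdd_above ((\<lambda>x. \<bar>A x - B x\<bar>) ` S)"
proof (intro bdd_aboveI2)
  show "\<bar>A x - B x\<bar> \<le> 1" for x using assms(1-4)[of x] by linarith
qed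

lemma ecdf_eq_card: "ecdf n x t = real (card {i\<in>{1..n}. x i \<le> t}) / real n"
proof -
  have "{1..n} \<inter> {i. x i \<in> {..t}} = {i\<in>{1..n}. x i \<le> t}" by auto
  then show ?thesis unfolding ecdf_def
    by (simp add: indicator_def sum.If_cases atLeastAtMost_def atMost_def)
qed

text \<open>The witnessing set consists of the sample points up to t for an upward deviation and of
  those beyond t for a downward one, since 1 - F reverses the order. Its size exceeds n F(t) + n u,
  respectively n (1 - F(t)) + n u, and is therefore positive.\<close>

lemma crossing_of_ecdf:
  assumes F: "mono F" "\<And>x. 0 \<le> F x" "\<And>x. F x \<le> 1" and n: "0 < n" and u: "0 < u"
  shows "u < ecdf n x t - F t \<Longrightarrow> crossing {1..n} (real n * u) (\<lambda>i. real n * F (x i))"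
    and "u < F t - ecdf n x t \<Longrightarrow> crossing {1..n} (real n * u) (\<lambda>i. real n * (1 - F (x i)))"
proof -
  define S where "S = {i\<in>{1..n}. x i \<le> t}"
  define S' where "S' = {i\<in>{1..n}. t < x i}"
  have "card S + card S' = card (S \<union> S')" 
    by (rule card_Un_disjoint[symmetric]) (auto simp: S_def S'_def)
  also have "S \<union> S' = {1..n}" by (auto simp: S_def S'_def)
  finally have card: "real (card S) + real (card S') = real n" by simp
  { assume "u < ecdf n x t - F t"
    then have "u + F t < real (card S) / real n" unfolding ecdf_eq_card S_def by simp
    then have *: "real n * F t < real (card S) - real n * u" using n by (simp add: field_simps)
    moreover have "0 \<le> real n * F t" "0 < real n * u" using F(2) n u by auto
    ultimately have "0 < real (card S)" by linarith
    then have "S \<noteq> {}" by auto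
    moreover have "real n * F (x i) < real (card S) - real n * u" if "i \<in> S" for i
      using * that monoD[OF F(1), of "x i" t] n unfolding S_def
      by (auto intro: order.strict_trans1[OF mult_left_mono])
    ultimately show "crossing {1..n} (real n * u) (\<lambda>i. real n * F (x i))"
      unfolding crossing_def by (intro exI[of _ S]) (auto simp: S_def) }
  { assume "u < F t - ecdf n x t"
    then have "u + real (card S) / real n < F t" unfolding ecdf_eq_card S_def by simp
    then have *: "real n * (1 - F t) < real (card S') - real n * u" using n card by (simp add: field_simps)
    moreover have "0 \<le> real n * (1 - F t)" "0 < real n * u" using F(3) n u by auto
    ultimately have "0 < real (card S')" by linarith
    then have "S' \<noteq> {}" by auto
    moreover have "real n * (1 - F (x i)) < real (card S') - real n * u" if "i \<in> S'" for i
    proof -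
      have "F t \<le> F (x i)" using that F(1) unfolding S'_def by (auto intro: monoD)
      then have "real n * (1 - F (x i)) \<le> real n * (1 - F t)" by (intro mult_left_mono) auto
      then show ?thesis using * by linarith
    qed
    ultimately show "crossing {1..n} (real n * u) (\<lambda>i. real n * (1 - F (x i)))"
      unfolding crossing_def by (intro exI[of _ S']) (auto simp: S'_def) }
qed

text \<open>The factor 2 comes from the union of the upward and the downward crossing event. The
  supremum runs over the rationals so that it is a random variable; \<open>le_SUP_Rats\<close>
  recovers all real arguments.\<close>

theorem (in prob_space) dvoretzky_kiefer_wolfowitz_massart:
  assumes X: "indep_vars (\<lambda>_. borel) X {1..n}" and n: "0 < n"
    and F: "\<And>i. i \<in> {1..n} \<Longrightarrow> cdf (distr M borel (X i)) = F" "continuous_on UNIV F" and u: "0 < u"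
  shows "prob {\<omega>\<in>space M. u < (SUP q\<in>\<rat>. \<bar>ecdf n (\<lambda>i. X i \<omega>) q - F q\<bar>)} \<le> 2 * exp (- (2 * real n * u\<^sup>2))"
proof -
  have rv[measurable]: "random_variable borel (X i)" if "i \<in> {1..n}" for i
    using X that unfolding indep_vars_def by auto
  have [measurable]: "F \<in> borel_measurable borel" by (rule borel_measurable_continuous_onI) fact
  have 1: "1 \<in> {1..n}" using n by simp
  interpret X1: real_distribution "distr M borel (X 1)" using rv[OF 1] by (rule real_distribution_distr)
  have F01: "0 \<le> F x" "F x \<le> 1" and mono: "mono F" for x
    using X1.cdf_nonneg[of x] X1.cdf_bounded_prob[of x] X1.cdf_nondecreasing unfolding F(1)[OF 1] mono_def by auto
  define W where "W i \<omega> = real n * F (X i \<omega>)" for i \<omega>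
  define W' where "W' i \<omega> = real n * (1 - F (X i \<omega>))" for i \<omega>
  have W: "indep_vars (\<lambda>_. borel) W {1..n}" unfolding W_def
    by (rule indep_vars_compose2[OF X, where Y = "\<lambda>_ x. real n * F x"]) simp
  have W': "indep_vars (\<lambda>_. borel) W' {1..n}" unfolding W'_def
    by (rule indep_vars_compose2[OF X, where Y = "\<lambda>_ x. real n * (1 - F x)"]) simp
  have UW: "distr M borel (W i) = uniform_measure lborel {0..real n}"
    and UW': "distr M borel (W' i) = uniform_measure lborel {0..real n}" if "i \<in> {1..n}" for i
    unfolding W_def W'_def
    using distr_cdf_eq_uniform[OF rv[OF that] F(1)[OF that] F(2)]
      distr_1_minus_cdf_eq_uniform[OF rv[OF that] F(1)[OF that] F(2)] n by simp_all
  have rangeW: "W i \<omega> \<in> {0..real n}" and rangeW': "W' i \<omega> \<in> {0..real n}" for i \<omega>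
    unfolding W_def W'_def using F01[of "X i \<omega>"] by (simp_all add: mult_left_le)
  have y: "0 < real n * u" using n u by simp
  define E where "E = {\<omega>\<in>space M. crossing {1..n} (real n * u) (\<lambda>i. W i \<omega>)}"
  define E' where "E' = {\<omega>\<in>space M. crossing {1..n} (real n * u) (\<lambda>i. W' i \<omega>)}"
  have meas: "{\<omega>\<in>space M. crossing {1..n} y (\<lambda>i. V i \<omega>)} \<in> events" if V: "indep_vars (\<lambda>_. borel) V {1..n}" for V y
  proof -
    have "(\<lambda>\<omega>. \<lambda>i\<in>{1..n}. V i \<omega>) \<in> measurable M (PiM {1..n} (\<lambda>_. borel))"
      using V unfolding indep_vars_def by (intro measurable_restrict) auto
    moreover have "Measurable.pred (PiM {1..n} (\<lambda>_. borel :: real measure)) (crossing {1..n} y)"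
      by (intro pred_crossing) auto
    ultimately have "Measurable.pred M (\<lambda>\<omega>. crossing {1..n} y (\<lambda>i\<in>{1..n}. V i \<omega>))"
      by (rule measurable_compose)
    then show ?thesis by (simp add: crossing_restrict_iff pred_def)
  qed
  have E: "E \<in> events" "E' \<in> events" unfolding E_def E'_def using meas W W' by auto
  have "prob {\<omega>\<in>space M. u < (SUP q\<in>\<rat>. \<bar>ecdf n (\<lambda>i. X i \<omega>) q - F q\<bar>)} \<le> prob (E \<union> E')"
  proof (rule finite_measure_mono)
    show "{\<omega>\<in>space M. u < (SUP q\<in>\<rat>. \<bar>ecdf n (\<lambda>i. X i \<omega>) q - F q\<bar>)} \<subseteq> E \<union> E'"
    proof safe
      fix \<omega> assume \<omega>: "\<omega> \<in> space M" "u < (SUP q\<in>\<rat>. \<bar>ecdf n (\<lambda>i. X i \<omega>) q - F q\<bar>)" "\<omega> \<notin> E'"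
      have "\<exists>q\<in>\<rat>. u < \<bar>ecdf n (\<lambda>i. X i \<omega>) q - F q\<bar>"
        using \<omega>(2) by (subst (asm) less_cSUP_iff) (auto intro!: bdd_above_abs_diff ecdf_bounds F01 exI[of _ 0])
      then obtain q where "u < \<bar>ecdf n (\<lambda>i. X i \<omega>) q - F q\<bar>" by blast
      then show "\<omega> \<in> E"
        using \<omega> crossing_of_ecdf[OF mono F01 n u, where x = "\<lambda>i. X i \<omega>" and t = q] unfolding E_def E'_def W_def W'_def
        by (auto simp: abs_real_def split: if_splits)
    qed
  qed (use E in auto)
  also have "\<dots> \<le> prob E + prob E'" using E by (rule measure_Un_le)
  also have "prob E \<le> exp (- (2 * (real n * u)\<^sup>2 / real n))" unfolding E_def
    using W n y UW rangeW by (intro prob_crossing_le) auto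
  also have "prob E' \<le> exp (- (2 * (real n * u)\<^sup>2 / real n))" unfolding E'_def
    using W' n y UW' rangeW' by (intro prob_crossing_le) auto
  also have "2 * (real n * u)\<^sup>2 / real n = 2 * real n * u\<^sup>2" using n by (simp add: power2_eq_square)
  finally show ?thesis by simp
qed

section \<open>Convolution of the tails\<close>

lemma has_real_derivative_erf: "(erf has_real_derivative 2 / sqrt pi * exp (- t\<^sup>2)) (at t)"
proof -
  have "((\<lambda>u. LBINT y=ereal 0..u. exp (- y\<^sup>2)) has_vector_derivative exp (- t\<^sup>2)) (at t within {- \<bar>t\<bar> - 1..\<bar>t\<bar> + 1})"
    by (rule interval_integral_FTC2) (auto intro!: continuous_intros)
  then have "((\<lambda>u. LBINT y=0..u. exp (- y\<^sup>2)) has_vector_derivative exp (- t\<^sup>2)) (at t)"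
    by (subst (asm) at_within_interior) (auto simp: zero_ereal_def)
  then have "((\<lambda>u. LBINT y=0..ereal u. exp (- y\<^sup>2)) has_real_derivative exp (- t\<^sup>2)) (at t)"
    by (simp add: has_real_derivative_iff_has_vector_derivative)
  from DERIV_cmult[OF this, of "2 / sqrt pi"] show ?thesis
    unfolding erf_def by simp
qed

lemma erf_minus: "erf (- t) = - erf t"
proof -
  have "((\<lambda>t. erf t + erf (- t)) has_real_derivative 0) (at t)" for t
    by (auto intro!: derivative_eq_intros DERIV_chain'[OF _ has_real_derivative_erf] has_real_derivative_erf)
  then have "erf t + erf (- t) = erf 0 + erf (- 0)"
    by (intro DERIV_isconst_all[of "\<lambda>t. erf t + erf (- t)"]) auto
  moreover have "erf 0 = 0" unfolding erf_def by (simp flip: zero_ereal_def)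
  ultimately show ?thesis by simp
qed

text \<open>An antiderivative of \<open>16 m (z - s) exp (-2ns\<^sup>2 - 2m(z - s)\<^sup>2)\<close>, found by completing the square
  at \<open>s = m z / (m + n)\<close>.\<close>

definition gauss_convolution :: "real \<Rightarrow> real \<Rightarrow> real \<Rightarrow> real \<Rightarrow> real" where
  "gauss_convolution n m z s = exp (- (2 * m * n * z\<^sup>2 / (m + n))) *
     (sqrt (32 * pi) * z * (m * n / (m + n) powr (3 / 2)) * erf (sqrt (2 * (m + n)) * (s - m * z / (m + n)))
      + 4 * m / (m + n) * exp (- 2 * (m + n) * (s - m * z / (m + n))\<^sup>2))"

lemma complete_square:
  fixes n m z s :: real
  assumes "0 < n" "0 < m"
  shows "exp (- (2 * m * n * z\<^sup>2 / (m + n))) * exp (- 2 * (m + n) * (s - m * z / (m + n))\<^sup>2)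
    = exp (- 2 * n * s\<^sup>2) * exp (- 2 * m * (z - s)\<^sup>2)"
proof -
  have "m + n \<noteq> 0" using assms by simp
  then have "- (2 * m * n * z\<^sup>2 / (m + n)) + - 2 * (m + n) * (s - m * z / (m + n))\<^sup>2 = - 2 * n * s\<^sup>2 + - 2 * m * (z - s)\<^sup>2"
    by (simp add: divide_simps power2_eq_square) algebra
  then show ?thesis unfolding exp_add[symmetric] by simp
qed

lemma powr_three_halves: "0 < x \<Longrightarrow> x powr (3 / 2) = x * sqrt x" for x :: real
  using powr_add[of x 1 "1/2"] by (simp add: powr_half_sqrt)

text \<open>With c = m z / N the factor z - s is n z / N - (s - c). The \<open>erf\<close> term
  contributes the constant part n z / N, and the Gaussian term contributes - (s - c).\<close>

lemma has_derivative_gauss_convolution: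
  assumes n: "0 < n" and m: "0 < m"
  shows "(gauss_convolution n m z has_real_derivative
    2 * exp (- 2 * n * s\<^sup>2) * (8 * m * (z - s) * exp (- 2 * m * (z - s)\<^sup>2))) (at s)"
proof -
  define N where "N = m + n"
  define c where "c = m * z / N"
  define K where "K = exp (- (2 * m * n * z\<^sup>2 / N))"
  define a where "a = sqrt (32 * pi) * z * (m * n / N powr (3 / 2))"
  have N: "0 < N" using n m by (simp add: N_def)
  have "((\<lambda>s. K * (a * erf (sqrt (2 * N) * (s - c)) + 4 * m / N * exp (- 2 * N * (s - c)\<^sup>2))) has_real_derivative
     K * (a * (2 / sqrt pi * exp (- (sqrt (2 * N) * (s - c))\<^sup>2) * sqrt (2 * N)) + 4 * m / N * (exp (- 2 * N * (s - c)\<^sup>2) * (- 4 * N * (s - c))))) (at s)"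
    by (auto intro!: derivative_eq_intros DERIV_chain'[OF _ has_real_derivative_erf]) (simp add: algebra_simps)
  also have "(sqrt (2 * N) * (s - c))\<^sup>2 = 2 * N * (s - c)\<^sup>2" using N by (simp add: power_mult_distrib)
  also have "a * (2 / sqrt pi * exp (- (2 * N * (s - c)\<^sup>2)) * sqrt (2 * N)) = 16 * m * (n * z / N) * exp (- 2 * N * (s - c)\<^sup>2)"
  proof -
    have "sqrt (32 * pi) = 4 * sqrt 2 * sqrt pi" using real_sqrt_mult[of 16 2] by (simp add: real_sqrt_mult)
    then have "a * (2 / sqrt pi * sqrt (2 * N)) = 16 * m * (n * z / N)"
      unfolding a_def powr_three_halves[OF N] real_sqrt_mult using N by (simp add: field_simps)
    then have "a * (2 / sqrt pi * sqrt (2 * N)) * exp (- 2 * N * (s - c)\<^sup>2) = 16 * m * (n * z / N) * exp (- 2 * N * (s - c)\<^sup>2)"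
      by simp
    then show ?thesis by (simp add: mult_ac)
  qed
  also have "K * (16 * m * (n * z / N) * exp (- 2 * N * (s - c)\<^sup>2) + 4 * m / N * (exp (- 2 * N * (s - c)\<^sup>2) * (- 4 * N * (s - c))))
     = (K * exp (- 2 * N * (s - c)\<^sup>2)) * (16 * m * (n * z / N - (s - c)))"
    using N by (simp add: field_simps)
  also have "K * exp (- 2 * N * (s - c)\<^sup>2) = exp (- 2 * n * s\<^sup>2) * exp (- 2 * m * (z - s)\<^sup>2)"
    unfolding K_def c_def N_def by (rule complete_square[OF n m])
  also have "n * z / N - (s - c) = z - s"
  proof -
    have "n * z / N + c = N * z / N" unfolding c_def add_divide_distrib[symmetric] N_def by (simp add: algebra_simps)
    then have "n * z / N + c = z" using N by simp
    then show ?thesis by linarith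
  qed
  also have "exp (- 2 * n * s\<^sup>2) * exp (- 2 * m * (z - s)\<^sup>2) * (16 * m * (z - s))
     = 2 * exp (- 2 * n * s\<^sup>2) * (8 * m * (z - s) * exp (- 2 * m * (z - s)\<^sup>2))" by simp
  finally show ?thesis unfolding gauss_convolution_def[abs_def] K_def a_def c_def N_def .
qed

text \<open>Here u is the level at which 2 exp (-2nu^2) equals 1. Then sqrt (ln 4 / n) = 2u and 2
  powr (1 - m/n) = 2 exp (-2mu^2), so the first term of the bound is a Gaussian in z - u.\<close>

lemma ks_bound_eq:
  fixes n m :: nat
  assumes n: "0 < n" and m: "0 < m" and z: "0 \<le> z"
  defines "u \<equiv> sqrt (ln 2 / (2 * real n))" and "N \<equiv> real m + real n"
  shows "ks_bound n m z = 2 * real n / N * exp (- 2 * real m * (z - u)\<^sup>2)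
    + sqrt (32 * pi) * z * (real m * real n / N powr (3 / 2)) * exp (- (2 * real m * real n * z\<^sup>2 / N))
       * erf (sqrt (2 * N) * (real m * z / N - u))"
proof -
  have N: "0 < N" using n unfolding N_def by simp
  have u2: "u\<^sup>2 = ln 2 / (2 * real n)" unfolding u_def by simp
  have "ln 4 = 2 * ln (2 :: real)" using ln_realpow[of 2 2] by simp
  then have ln4: "ln 4 / real n = 4 * (ln 2 / (2 * real n))" by simp
  have u4: "sqrt (ln 4 / real n) = 2 * u" unfolding u_def ln4 real_sqrt_mult[of 4] by simp
  have "2 powr (1 - real m / real n) = 2 * exp (- (real m / real n * ln 2))"
    by (simp add: powr_def left_diff_distrib exp_diff exp_minus divide_inverse)
  then have "2 powr (1 - real m / real n) * exp (- 2 * real m * z * (z - sqrt (ln 4 / real n)))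
     = 2 * (exp (- (real m / real n * ln 2)) * exp (- 2 * real m * z * (z - 2 * u)))"
    unfolding u4 by simp
  also have "exp (- (real m / real n * ln 2)) * exp (- 2 * real m * z * (z - 2 * u)) = exp (- 2 * real m * (z - u)\<^sup>2)"
  proof -
    have "real m / real n * ln 2 = 2 * real m * u\<^sup>2" unfolding u2 by simp
    then show ?thesis unfolding exp_add[symmetric] by (simp add: power2_eq_square algebra_simps)
  qed
  finally have 1: "real n / N * 2 powr (1 - real m / real n) * exp (- 2 * real m * z * (z - sqrt (ln 4 / real n)))
    = 2 * real n / N * exp (- 2 * real m * (z - u)\<^sup>2)" by (simp add: mult.assoc)
  have "sqrt (2 * N) * (real m * z / N) = sqrt (2 * (real m)\<^sup>2 * z\<^sup>2 / N)"
  proof -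
    have "sqrt (2 * (real m)\<^sup>2 * z\<^sup>2 / N) = sqrt (2 * N * (real m * z / N)\<^sup>2)"
      using N by (intro arg_cong[where f = sqrt]) (simp add: power2_eq_square field_simps)
    then show ?thesis using z N by (simp add: real_sqrt_mult)
  qed
  moreover have "sqrt (2 * N) * u = sqrt (N * ln 2 / real n)"
    unfolding u_def real_sqrt_mult[symmetric] by simp
  ultimately have 2: "sqrt (2 * (real m)\<^sup>2 * z\<^sup>2 / N) - sqrt (N * ln 2 / real n) = sqrt (2 * N) * (real m * z / N - u)"
    by (simp add: right_diff_distrib)
  show ?thesis unfolding ks_bound_def N_def[symmetric] 1 2 ..
qed

text \<open>At each end of [u, z - v] one of the two Gaussian factors is 1/2. The share m/N of the
  initial value cancels the Gaussian boundary term at u, and the share n/N is the first term of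
  \<open>ks_bound n m z\<close>. The boundary term at z - v is the first term of
  \<open>ks_bound m n z\<close>. Oddness of \<open>erf\<close> makes both remaining terms positive
  multiples of \<open>erf\<close>.\<close>

lemma gauss_convolution_eq_ks_bound:
  fixes n m :: nat
  assumes n: "0 < n" and m: "0 < m" and z: "0 \<le> z"
  defines "u \<equiv> sqrt (ln 2 / (2 * real n))" and "v \<equiv> sqrt (ln 2 / (2 * real m))"
  shows "2 * exp (- 2 * real m * (z - u)\<^sup>2)
     + (gauss_convolution (real n) (real m) z (z - v) - gauss_convolution (real n) (real m) z u)
     = ks_bound n m z + ks_bound m n z"
proof -
  define N where "N = real m + real n"
  define K where "K = exp (- (2 * real m * real n * z\<^sup>2 / N))"
  define a where "a = sqrt (32 * pi) * z * (real m * real n / N powr (3 / 2))"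
  have N: "0 < N" using n unfolding N_def by simp
  have eu: "exp (- 2 * real n * u\<^sup>2) = 1/2"
    using n unfolding u_def by (simp add: exp_minus)
  have ev: "exp (- 2 * real m * v\<^sup>2) = 1/2"
    using m unfolding v_def by (simp add: exp_minus)
  have sq: "K * exp (- 2 * N * (s - real m * z / N)\<^sup>2) = exp (- 2 * real n * s\<^sup>2) * exp (- 2 * real m * (z - s)\<^sup>2)" for s
    unfolding K_def N_def using n m by (intro complete_square) auto
  have G: "gauss_convolution (real n) (real m) z s = a * K * erf (sqrt (2 * N) * (s - real m * z / N))
     + 4 * real m / N * (exp (- 2 * real n * s\<^sup>2) * exp (- 2 * real m * (z - s)\<^sup>2))" for s
    unfolding gauss_convolution_def sq[symmetric] unfolding a_def K_def N_def by (simp add: algebra_simps)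
  have neg: "sqrt (2 * N) * (u - real m * z / N) = - (sqrt (2 * N) * (real m * z / N - u))"
    by (simp add: right_diff_distrib)
  have lin: "x * K * - r + 4 * p / N * (1/2 * E) = - (x * K * r) + 2 * p / N * E"
    and lin': "4 * p / N * (E * (1/2)) = 2 * p / N * E" for x r p E :: real
    by simp_all
  have Gu: "gauss_convolution (real n) (real m) z u = - (a * K * erf (sqrt (2 * N) * (real m * z / N - u)))
     + 2 * real m / N * exp (- 2 * real m * (z - u)\<^sup>2)"
    unfolding G[of u] eu neg erf_minus by (rule lin)
  have c: "z - v - real m * z / N = real n * z / N - v"
    using N unfolding N_def by (simp add: field_simps)
  have Gv: "gauss_convolution (real n) (real m) z (z - v) = a * K * erf (sqrt (2 * N) * (real n * z / N - v))
     + 2 * real m / N * exp (- 2 * real n * (z - v)\<^sup>2)"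
    unfolding G[of "z - v"] c diff_diff_eq2 add_diff_cancel_left' ev lin' ..
  have b1: "ks_bound n m z = 2 * real n / N * exp (- 2 * real m * (z - u)\<^sup>2) + a * K * erf (sqrt (2 * N) * (real m * z / N - u))"
    unfolding ks_bound_eq[OF n m z] a_def K_def N_def u_def by simp
  have b2: "ks_bound m n z = 2 * real m / N * exp (- 2 * real n * (z - v)\<^sup>2) + a * K * erf (sqrt (2 * N) * (real n * z / N - v))"
    unfolding ks_bound_eq[OF m n z] a_def K_def N_def v_def by (simp add: mult_ac add.commute)
  have "2 * real n / N + 2 * real m / N = 2 * N / N"
    unfolding add_divide_distrib[symmetric] N_def distrib_left by (simp only: add.commute)
  also have "\<dots> = 2" using N by simp
  finally have "2 * real n / N + 2 * real m / N = 2" .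
  then have "2 * e = 2 * real n / N * e + 2 * real m / N * e" for e :: real
    unfolding distrib_right[symmetric] by simp
  note this[of "exp (- 2 * real m * (z - u)\<^sup>2)"]
  then show ?thesis unfolding Gu Gv b1 b2 by linarith
qed

lemma nn_integral_gauss_density:
  fixes m z a b :: real
  assumes "0 < m" "a \<le> b" "b \<le> z"
  shows "(\<integral>\<^sup>+s. ennreal (8 * m * (z - s) * exp (- 2 * m * (z - s)\<^sup>2)) * indicator {a..b} s \<partial>lborel)
    = ennreal (2 * exp (- 2 * m * (z - b)\<^sup>2) - 2 * exp (- 2 * m * (z - a)\<^sup>2))"
proof -
  have deriv: "((\<lambda>s. 2 * exp (- 2 * m * (z - s)\<^sup>2)) has_real_derivative 8 * m * (z - s) * exp (- 2 * m * (z - s)\<^sup>2)) (at s)" for s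
  proof -
    have "((\<lambda>s. z - s) has_real_derivative - 1) (at s)"
      by (auto intro!: derivative_eq_intros)
    note DERIV_cmult[OF DERIV_fun_exp[OF DERIV_cmult[OF DERIV_power[OF this, of 2], of "- 2 * m"]], of 2]
    moreover have "2 * (exp (- 2 * m * (z - s)\<^sup>2) * (- 2 * m * (real 2 * (- 1 * (z - s) ^ (2 - Suc 0)))))
        = 8 * m * (z - s) * exp (- 2 * m * (z - s)\<^sup>2)"
      by (simp only: diff_Suc_Suc numeral_2_eq_2 diff_zero power_Suc power_0 of_nat_Suc of_nat_0 mult_1_right) algebra
    ultimately show ?thesis by (rule DERIV_cong)
  qed
  have nonneg: "0 \<le> 8 * m * (z - s) * exp (- 2 * m * (z - s)\<^sup>2)" if "s \<le> b" for s
    using assms that by auto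
  show ?thesis
    by (rule nn_integral_FTC_Icc[where f = "\<lambda>s. 8 * m * (z - s) * exp (- 2 * m * (z - s)\<^sup>2)",
          OF _ has_field_derivative_at_within[OF deriv] _ \<open>a \<le> b\<close>])
       (measurable, use nonneg in auto)
qed

text \<open>The tail bound for \<^term>\<open>V\<close> at level \<^term>\<open>z - x\<close>, as a function of \<^term>\<open>x\<close>, is an initial value plus an
  integral over \<open>{s. s < x}\<close>; integrating it against the law of \<^term>\<open>U\<close> brings in the tails of \<^term>\<open>U\<close>.\<close>

lemma (in prob_space) prob_sum_le_ks_bound:
  fixes n m :: nat and U V :: "'a \<Rightarrow> real"
  assumes indep: "indep_var borel U borel V" and n: "0 < n" and m: "0 < m"
    and tailU: "\<And>u. 0 < u \<Longrightarrow> prob {\<omega>\<in>space M. u < U \<omega>} \<le> 2 * exp (- (2 * real n * u\<^sup>2))"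
    and tailV: "\<And>u. 0 < u \<Longrightarrow> prob {\<omega>\<in>space M. u < V \<omega>} \<le> 2 * exp (- (2 * real m * u\<^sup>2))"
    and z: "sqrt (ln 2 / (2 * real n)) + sqrt (ln 2 / (2 * real m)) \<le> z"
  shows "prob {\<omega>\<in>space M. z < U \<omega> + V \<omega>} \<le> ks_bound n m z + ks_bound m n z"
proof -
  define u where "u = sqrt (ln 2 / (2 * real n))"
  define v where "v = sqrt (ln 2 / (2 * real m))"
  have u: "0 < u" and v: "0 < v" and uz: "u \<le> z - v" unfolding u_def v_def using n m z by auto
  have [measurable]: "random_variable borel U" "random_variable borel V"
    using indep by (blast dest: indep_var_rv1 indep_var_rv2)+
  define PU where "PU = distr M borel U"
  define PV where "PV = distr M borel V"
  interpret PU: prob_space PU unfolding PU_def by (rule prob_space_distr) simp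
  interpret PV: prob_space PV unfolding PV_def by (rule prob_space_distr) simp
  interpret P: pair_sigma_finite PU PV ..
  interpret Q: pair_sigma_finite lborel PU ..
  have [measurable_cong]: "sets PU = sets borel" "sets PV = sets borel" unfolding PU_def PV_def by auto
  \<comment> \<open>\<open>h\<close> is the initial value of the tail bound for \<open>V\<close> at
    level z - u, and \<open>g\<close> is the density by which it grows in s. The cutoffs are where
    the bounds become trivial: the one for \<open>U\<close> reaches 1 at u, the one for
    \<open>V\<close> at z - s = v.\<close>
  define h where "h = 2 * exp (- 2 * real m * (z - u)\<^sup>2)"
  define g where "g s = ennreal (8 * real m * (z - s) * exp (- 2 * real m * (z - s)\<^sup>2)) * indicator {u..z - v} s" for s
  have [measurable]: "g \<in> borel_measurable borel" unfolding g_def by measurable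
  define d where "d s = 2 * exp (- 2 * real n * s\<^sup>2) * (8 * real m * (z - s) * exp (- 2 * real m * (z - s)\<^sup>2))" for s
  have d_measurable: "d \<in> borel_measurable borel" unfolding d_def by measurable
  have deriv: "(gauss_convolution (real n) (real m) z has_real_derivative d s) (at s)" for s
    unfolding d_def using n m by (intro has_derivative_gauss_convolution) auto
  have nonneg: "0 \<le> d s" if "u \<le> s" "s \<le> z - v" for s
    unfolding d_def using that v by auto
  have mono: "gauss_convolution (real n) (real m) z u \<le> gauss_convolution (real n) (real m) z (z - v)"
    using uz by (rule DERIV_nonneg_imp_nondecreasing[where f = "gauss_convolution (real n) (real m) z"]) (use deriv nonneg in blast)
  have PV_le: "emeasure PV {x<..} \<le> ennreal (2 * exp (- 2 * real m * x\<^sup>2))" if "0 < x" for x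
  proof -
    have "emeasure PV {x<..} = emeasure M {\<omega>\<in>space M. x < V \<omega>}"
      unfolding PV_def by (subst emeasure_distr) (auto intro!: arg_cong[where f = "emeasure M"])
    then show ?thesis using tailV[OF that] unfolding emeasure_eq_measure by (simp add: ennreal_leI)
  qed
  have PU_le: "emeasure PU {x<..} \<le> ennreal (2 * exp (- 2 * real n * x\<^sup>2))" if "0 < x" for x
  proof -
    have "emeasure PU {x<..} = emeasure M {\<omega>\<in>space M. x < U \<omega>}"
      unfolding PU_def by (subst emeasure_distr) (auto intro!: arg_cong[where f = "emeasure M"])
    then show ?thesis using tailU[OF that] unfolding emeasure_eq_measure by (simp add: ennreal_leI)
  qed
  have tail: "emeasure PV {z - x<..} \<le> ennreal h + (\<integral>\<^sup>+s. g s * indicator {..<x} s \<partial>lborel)" for x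
  proof (cases "x \<le> u")
    case True
    have "emeasure PV {z - x<..} \<le> emeasure PV {z - u<..}" using True by (intro emeasure_mono) auto
    also have "\<dots> \<le> ennreal h" unfolding h_def using uz v by (intro PV_le) auto
    finally show ?thesis by (simp add: add_increasing2)
  next
    case False
    \<comment> \<open>Past z - v the bound for \<open>V\<close> is frozen at its value 1, where it
      holds because \<open>PV\<close> is a probability measure.\<close>
    define b where "b = min x (z - v)"
    have b: "u \<le> b" "b \<le> z - v" "b \<le> x" using False uz unfolding b_def by auto
    have "emeasure PV {z - x<..} \<le> ennreal (2 * exp (- 2 * real m * (z - b)\<^sup>2))"
    proof (cases "x \<le> z - v")
      case True
      then show ?thesis unfolding b_def using v PV_le[of "z - x"] by simp
    next
      case False
      have "2 * exp (- 2 * real m * v\<^sup>2) = 1" using m unfolding v_def by (simp add: exp_minus)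
      then show ?thesis unfolding b_def using False by (simp add: PV.measure_le_1)
    qed
    also have "\<dots> = ennreal (h + (2 * exp (- 2 * real m * (z - b)\<^sup>2) - h))" by simp
    also have "\<dots> = ennreal h + ennreal (2 * exp (- 2 * real m * (z - b)\<^sup>2) - h)"
    proof (rule ennreal_plus)
      have "(z - b)\<^sup>2 \<le> (z - u)\<^sup>2" using b v by (intro power_mono) auto
      then show "0 \<le> 2 * exp (- 2 * real m * (z - b)\<^sup>2) - h" unfolding h_def by (simp add: mult_left_mono)
    qed (simp add: h_def)
    also have "ennreal (2 * exp (- 2 * real m * (z - b)\<^sup>2) - h) = (\<integral>\<^sup>+s. ennreal (8 * real m * (z - s) * exp (- 2 * real m * (z - s)\<^sup>2)) * indicator {u..b} s \<partial>lborel)"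
      unfolding h_def using m b v by (intro nn_integral_gauss_density[symmetric]) auto
    \<comment> \<open>The closed interval up to b and the half-line s < x can disagree only at s =
      x, a null set. The strict form is kept because it becomes P(U > s) after Fubini.\<close>
    also have "\<dots> \<le> (\<integral>\<^sup>+s. g s * indicator {..<x} s \<partial>lborel)"
    proof (rule nn_integral_mono_AE)
      show "AE s in lborel. ennreal (8 * real m * (z - s) * exp (- 2 * real m * (z - s)\<^sup>2)) * indicator {u..b} s \<le> g s * indicator {..<x} s"
        using AE_lborel_singleton[of x]
        by eventually_elim (use b in \<open>auto simp: g_def indicator_def\<close>)
    qed
    finally show ?thesis by (simp add: add_left_mono)
  qed
  have "{p \<in> space (borel \<Otimes>\<^sub>M borel). z < fst p + snd p} \<in> sets (borel \<Otimes>\<^sub>M (borel :: real measure))"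
    by measurable
  then have Z: "{p. z < fst p + snd p} \<in> sets (borel \<Otimes>\<^sub>M (borel :: real measure))"
    by (simp add: space_pair_measure)
  have Z': "{p. z < fst p + snd p} \<in> sets (PU \<Otimes>\<^sub>M PV)"
    using Z sets_pair_measure_cong[of PU borel PV borel] unfolding PU_def PV_def by simp
  \<comment> \<open>Exchanging the integrals replaces the law of \<open>U\<close> by its tails P(U >
    s), for which a bound is available.\<close>
  have "(\<integral>\<^sup>+x. (\<integral>\<^sup>+s. g s * indicator {..<x} s \<partial>lborel) \<partial>PU) = (\<integral>\<^sup>+s. (\<integral>\<^sup>+x. g s * indicator {..<x} s \<partial>PU) \<partial>lborel)"
    by (rule Q.Fubini') (auto simp: lessThan_def)
  also have "\<dots> = (\<integral>\<^sup>+s. g s * emeasure PU {s<..} \<partial>lborel)"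
  proof (rule nn_integral_cong)
    fix s
    have "(\<integral>\<^sup>+x. g s * indicator {..<x} s \<partial>PU) = (\<integral>\<^sup>+x. g s * indicator {s<..} x \<partial>PU)"
      by (intro nn_integral_cong) (auto simp: indicator_def)
    then show "(\<integral>\<^sup>+x. g s * indicator {..<x} s \<partial>PU) = g s * emeasure PU {s<..}"
      by (simp add: nn_integral_cmult_indicator)
  qed
  also have "\<dots> \<le> (\<integral>\<^sup>+s. ennreal (2 * exp (- 2 * real n * s\<^sup>2) * (8 * real m * (z - s) * exp (- 2 * real m * (z - s)\<^sup>2))) * indicator {u..z - v} s \<partial>lborel)"
  proof (rule nn_integral_mono)
    fix s
    show "g s * emeasure PU {s<..} \<le> ennreal (2 * exp (- 2 * real n * s\<^sup>2) * (8 * real m * (z - s) * exp (- 2 * real m * (z - s)\<^sup>2))) * indicator {u..z - v} s"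
    proof (cases "s \<in> {u..z - v}")
      case True
      then have "0 < s" using u by auto
      from mult_left_mono[OF PU_le[OF this], of "g s"] show ?thesis
        using True by (simp add: g_def ennreal_mult'[symmetric] mult.commute)
    qed (simp add: g_def)
  qed
  also have "\<dots> = ennreal (gauss_convolution (real n) (real m) z (z - v) - gauss_convolution (real n) (real m) z u)"
    unfolding d_def[symmetric]
    by (rule nn_integral_FTC_Icc[OF d_measurable has_field_derivative_at_within[OF deriv] _ uz]) (use nonneg in auto)
  finally have integral_le: "(\<integral>\<^sup>+x. (\<integral>\<^sup>+s. g s * indicator {..<x} s \<partial>lborel) \<partial>PU)
     \<le> ennreal (gauss_convolution (real n) (real m) z (z - v) - gauss_convolution (real n) (real m) z u)" .
  have "emeasure M {\<omega>\<in>space M. z < U \<omega> + V \<omega>} = emeasure (PU \<Otimes>\<^sub>M PV) {p. z < fst p + snd p}"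
  proof -
    have "PU \<Otimes>\<^sub>M PV = distr M (borel \<Otimes>\<^sub>M borel) (\<lambda>\<omega>. (U \<omega>, V \<omega>))"
      using indep unfolding PU_def PV_def indep_var_distribution_eq by simp
    then show ?thesis using Z by (simp, subst emeasure_distr) (auto intro!: arg_cong[where f = "emeasure M"])
  qed
  also have "\<dots> = (\<integral>\<^sup>+x. emeasure PV (Pair x -` {p. z < fst p + snd p}) \<partial>PU)"
    by (rule PV.emeasure_pair_measure_alt[OF Z'])
  also have "\<dots> = (\<integral>\<^sup>+x. emeasure PV {z - x<..} \<partial>PU)"
    by (intro nn_integral_cong arg_cong[where f = "emeasure PV"]) auto
  also have "\<dots> \<le> (\<integral>\<^sup>+x. ennreal h + (\<integral>\<^sup>+s. g s * indicator {..<x} s \<partial>lborel) \<partial>PU)"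
    by (intro nn_integral_mono tail)
  also have "\<dots> = (\<integral>\<^sup>+x. ennreal h \<partial>PU) + (\<integral>\<^sup>+x. (\<integral>\<^sup>+s. g s * indicator {..<x} s \<partial>lborel) \<partial>PU)"
    by (rule nn_integral_add) (auto simp: lessThan_def)
  also have "(\<integral>\<^sup>+x. ennreal h \<partial>PU) = ennreal h" by (simp add: PU.emeasure_space_1)
  also have "ennreal h + (\<integral>\<^sup>+x. (\<integral>\<^sup>+s. g s * indicator {..<x} s \<partial>lborel) \<partial>PU)
     \<le> ennreal h + ennreal (gauss_convolution (real n) (real m) z (z - v) - gauss_convolution (real n) (real m) z u)"
    by (intro add_left_mono integral_le)
  finally have "emeasure M {\<omega>\<in>space M. z < U \<omega> + V \<omega>}
     \<le> ennreal h + ennreal (gauss_convolution (real n) (real m) z (z - v) - gauss_convolution (real n) (real m) z u)" .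
  also have "\<dots> = ennreal (h + (gauss_convolution (real n) (real m) z (z - v) - gauss_convolution (real n) (real m) z u))"
    using mono by (subst ennreal_plus) (auto simp: h_def)
  also have sum_eq: "h + (gauss_convolution (real n) (real m) z (z - v) - gauss_convolution (real n) (real m) z u) = ks_bound n m z + ks_bound m n z"
    unfolding h_def u_def v_def using n m uz u v by (intro gauss_convolution_eq_ks_bound) auto
  finally have "ennreal (prob {\<omega>\<in>space M. z < U \<omega> + V \<omega>}) \<le> ennreal (ks_bound n m z + ks_bound m n z)"
    unfolding emeasure_eq_measure .
  moreover have "0 \<le> ks_bound n m z + ks_bound m n z"
    unfolding sum_eq[symmetric] using mono by (simp add: h_def)
  ultimately show ?thesis by (simp add: ennreal_le_iff)
qed

section \<open>The two-sample inequality\<close>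

lemma ecdf_cong: "(\<And>i. i \<in> {1..n} \<Longrightarrow> x i = y i) \<Longrightarrow> ecdf n x t = ecdf n y t"
  unfolding ecdf_def by (intro arg_cong2[where f = "(*)"] sum.cong) auto

lemma continuous_at_right_ecdf: "continuous (at_right t) (ecdf n x)"
proof -
  have "((\<lambda>t. indicator {..t} a :: real) \<longlongrightarrow> indicator {..t} a) (at_right t)" for a
  proof (rule tendsto_eventually)
    show "\<forall>\<^sub>F s in at_right t. (indicator {..s} a :: real) = indicator {..t} a"
    proof (cases "a \<le> t")
      case True
      then show ?thesis by (auto simp: eventually_at_right_field intro!: exI[of _ "t + 1"])
    next
      case False
      then show ?thesis by (auto simp: eventually_at_right_field intro!: exI[of _ a])
    qed
  qed
  then show ?thesis unfolding continuous_within ecdf_def by (intro tendsto_intros)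
qed

text \<open>If f x exceeded the supremum, right continuity would make f exceed it on an interval to
  the right of x, and that interval contains a rational.\<close>

lemma le_SUP_Rats:
  fixes f :: "real \<Rightarrow> real"
  assumes f: "continuous (at_right x) f" and bdd: "bdd_above (f ` \<rat>)"
  shows "f x \<le> (SUP q\<in>\<rat>. f q)"
proof (rule ccontr)
  assume "\<not> ?thesis"
  then have "\<forall>\<^sub>F y in at_right x. (SUP q\<in>\<rat>. f q) < f y"
    using f unfolding continuous_within by (intro order_tendstoD(1)) auto
  then obtain b where b: "x < b" "\<And>y. x < y \<Longrightarrow> y < b \<Longrightarrow> (SUP q\<in>\<rat>. f q) < f y"
    unfolding eventually_at_right_field by auto
  then obtain q where "q \<in> \<rat>" "x < q" "q < b" using Rats_dense_in_real by blast
  then show False using b cSUP_upper[OF _ bdd, of q] by fastforce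
qed

lemma abs_diff_ks_dist_le:
  assumes A: "\<And>x. 0 \<le> A x" "\<And>x. A x \<le> 1" and B: "\<And>x. 0 \<le> B x" "\<And>x. B x \<le> 1"
    and C: "\<And>x. 0 \<le> C x" "\<And>x. C x \<le> 1" and D: "\<And>x. 0 \<le> D x" "\<And>x. D x \<le> 1"
    and S: "\<And>x. \<bar>A x - C x\<bar> \<le> S" and T: "\<And>x. \<bar>B x - D x\<bar> \<le> T"
  shows "\<bar>ks_dist A B - ks_dist C D\<bar> \<le> S + T"
proof -
  have up: "\<bar>A x - B x\<bar> \<le> ks_dist A B" "\<bar>C x - D x\<bar> \<le> ks_dist C D" for x
    unfolding ks_dist_def
    by (rule cSUP_upper[OF UNIV_I bdd_above_abs_diff[OF A B]], rule cSUP_upper[OF UNIV_I bdd_above_abs_diff[OF C D]])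
  have "ks_dist A B \<le> ks_dist C D + (S + T)"
    unfolding ks_dist_def[of A B]
  proof (rule cSUP_least)
    show "\<bar>A x - B x\<bar> \<le> ks_dist C D + (S + T)" for x
      using up[of x] S[of x] T[of x] by linarith
  qed simp
  moreover have "ks_dist C D \<le> ks_dist A B + (S + T)"
    unfolding ks_dist_def[of C D]
  proof (rule cSUP_least)
    show "\<bar>C x - D x\<bar> \<le> ks_dist A B + (S + T)" for x
      using up[of x] S[of x] T[of x] by linarith
  qed simp
  ultimately show ?thesis by linarith
qed

lemma borel_measurable_SUP_Rats_ecdf:
  assumes F: "\<And>x. 0 \<le> F x" "\<And>x. F x \<le> 1"
  shows "(\<lambda>x. SUP q\<in>\<rat>. \<bar>ecdf n x q - F q\<bar>) \<in> borel_measurable (PiM {1..n} (\<lambda>_. borel))"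
proof (rule borel_measurable_cSUP)
  show "countable (\<rat> :: real set)" by (rule countable_rat)
  show "bdd_above ((\<lambda>q. \<bar>ecdf n x q - F q\<bar>) ` \<rat>)" for x
    by (rule bdd_above_abs_diff[OF ecdf_bounds F])
  show "(\<lambda>x. \<bar>ecdf n x q - F q\<bar>) \<in> borel_measurable (PiM {1..n} (\<lambda>_. borel))" for q
    unfolding ecdf_def by measurable
qed

text \<open>With n = 2 r^2, where r is the scaling factor, every occurrence of n cancels and the two
  equal summands give \<open>ks_alpha1\<close>.\<close>

lemma ks_bound_diag:
  fixes n :: nat
  assumes n: "0 < n" and z: "0 \<le> z"
  shows "2 * ks_bound n n (z / sqrt (real n / 2)) = ks_alpha1 z"
proof -
  define r where "r = sqrt (real n / 2)"
  have r: "0 < r" "r\<^sup>2 = real n / 2" unfolding r_def using n by auto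
  have N: "real n = 2 * r\<^sup>2" using r by simp
  have ln4: "ln 4 = 2 * ln (2 :: real)" using ln_realpow[of 2 2] by simp
  have s1: "sqrt (ln 4 / real n) = sqrt (ln 2) / r"
    unfolding ln4 N using r by (simp add: real_sqrt_divide)
  have p: "(real n + real n) powr (3 / 2) = 8 * r ^ 3"
  proof -
    have "real n + real n = (2 * r)\<^sup>2" unfolding N by (simp add: power2_eq_square)
    then have "sqrt (real n + real n) = \<bar>2 * r\<bar>" by (simp only: real_sqrt_abs)
    then show ?thesis
      using powr_three_halves[of "real n + real n"] n r(1) unfolding N by (simp add: power2_eq_square power3_eq_cube)
  qed
  have s2: "sqrt (2 * (real n)\<^sup>2 * (z / r)\<^sup>2 / (real n + real n)) = sqrt 2 * z"
  proof -
    have "2 * (real n)\<^sup>2 * (z / r)\<^sup>2 / (real n + real n) = 2 * z\<^sup>2"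
      unfolding N using r(1) by (simp add: field_simps power2_eq_square)
    then show ?thesis using z by (simp add: real_sqrt_mult)
  qed
  have s3: "sqrt ((real n + real n) * ln 2 / real n) = sqrt 2 * sqrt (ln 2)"
    using n by (simp add: real_sqrt_mult[symmetric])
  have e1: "- 2 * real n * (z / r) * (z / r - sqrt (ln 2) / r) = - 4 * z * (z - sqrt (ln 2))"
    unfolding N using r(1) by (simp add: field_simps power2_eq_square)
  have e2: "2 * real n * real n * (z / r)\<^sup>2 / (real n + real n) = 2 * z\<^sup>2"
    unfolding N using r(1) by (simp add: field_simps power2_eq_square)
  have c: "(z / r) * (real n * real n / (8 * r ^ 3)) = z / 2"
    unfolding N using r(1) by (simp add: field_simps power2_eq_square power3_eq_cube)
  have h: "real n / (real n + real n) * 2 powr (1 - real n / real n) = 1 / 2" using n by simp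
  have "ks_bound n n (z / r) = 1 / 2 * exp (- 4 * z * (z - sqrt (ln 2)))
     + sqrt (32 * pi) * ((z / r) * (real n * real n / (8 * r ^ 3))) * exp (- (2 * z\<^sup>2)) * erf (sqrt 2 * z - sqrt 2 * sqrt (ln 2))"
    unfolding ks_bound_def h s1 s2 s3 e1 e2 p by (simp only: mult.assoc)
  then show ?thesis unfolding c ks_alpha1_def r_def[symmetric] right_diff_distrib by simp
qed

lemma is_cdf_bounds:
  assumes "is_cdf H"
  shows "0 \<le> H x" "H x \<le> 1"
proof -
  obtain P where P: "real_distribution P" "H = cdf P" using assms unfolding is_cdf_def by blast
  then interpret real_distribution P by simp
  show "0 \<le> H x" "H x \<le> 1" unfolding P(2) by (rule cdf_nonneg, rule cdf_bounded_prob)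
qed

theorem mainTheorem2:
  fixes M :: "'a measure"
    and F G :: "real \<Rightarrow> real"
    and X Y :: "nat \<Rightarrow> 'a \<Rightarrow> real"
    and n m :: nat
  assumes "prob_space M"
    and "is_cdf F" and "continuous_on UNIV F"
    and "is_cdf G" and "continuous_on UNIV G"
    and "n \<ge> 1" and "m \<ge> 1"
    and "prob_space.indep_vars M (\<lambda>_. borel) X {1..n}"
    and "\<And>i. i \<in> {1..n} \<Longrightarrow> cdf (distr M borel (X i)) = F"
    and "prob_space.indep_vars M (\<lambda>_. borel) Y {1..m}"
    and "\<And>j. j \<in> {1..m} \<Longrightarrow> cdf (distr M borel (Y j)) = G"
    and "prob_space.indep_var M
           (Pi\<^sub>M {1..n} (\<lambda>_. borel)) (\<lambda>\<omega>. \<lambda>i\<in>{1..n}. X i \<omega>)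
           (Pi\<^sub>M {1..m} (\<lambda>_. borel)) (\<lambda>\<omega>. \<lambda>j\<in>{1..m}. Y j \<omega>)"
  shows "(\<forall>z \<ge> sqrt (ln 2 / 2) * (real n powr (- 1 / 2) + real m powr (- 1 / 2)).
            \<P>(\<omega> in M. \<bar>ks_dist (ecdf n (\<lambda>i. X i \<omega>)) (ecdf m (\<lambda>j. Y j \<omega>)) - ks_dist F G\<bar> > z)
              \<le> ks_bound n m z + ks_bound m n z)
       \<and> (n = m \<longrightarrow> (\<forall>z \<ge> sqrt (ln 2).
            \<P>(\<omega> in M. sqrt (real n / 2) * 
                \<bar>ks_dist (ecdf n (\<lambda>i. X i \<omega>)) (ecdf n (\<lambda>j. Y j \<omega>)) - ks_dist F G\<bar> > z)
              \<le> ks_alpha1 z))"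
proof -
  interpret prob_space M by fact
  have n: "0 < n" and m: "0 < m" using assms by auto
  note F = is_cdf_bounds[OF assms(2)] and G = is_cdf_bounds[OF assms(4)]
  define U where "U = (\<lambda>\<omega>. SUP q\<in>\<rat>. \<bar>ecdf n (\<lambda>i. X i \<omega>) q - F q\<bar>)"
  define V where "V = (\<lambda>\<omega>. SUP q\<in>\<rat>. \<bar>ecdf m (\<lambda>j. Y j \<omega>) q - G q\<bar>)"
  \<comment> \<open>\<open>U\<close> and \<open>V\<close> are measurable functions of the two
    restricted sample vectors, so they inherit the independence of these vectors.\<close>
  have U_eq: "U = (\<lambda>x. SUP q\<in>\<rat>. \<bar>ecdf n x q - F q\<bar>) \<circ> (\<lambda>\<omega>. \<lambda>i\<in>{1..n}. X i \<omega>)"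
    unfolding U_def comp_def by (intro ext SUP_cong refl arg_cong[where f = "\<lambda>x. \<bar>x - _\<bar>"] ecdf_cong) simp
  have V_eq: "V = (\<lambda>x. SUP q\<in>\<rat>. \<bar>ecdf m x q - G q\<bar>) \<circ> (\<lambda>\<omega>. \<lambda>j\<in>{1..m}. Y j \<omega>)"
    unfolding V_def comp_def by (intro ext SUP_cong refl arg_cong[where f = "\<lambda>x. \<bar>x - _\<bar>"] ecdf_cong) simp
  have indep: "indep_var borel U borel V"
    unfolding U_eq V_eq using assms(12)
    by (rule indep_var_compose) (intro borel_measurable_SUP_Rats_ecdf F G)+
  have [measurable]: "random_variable borel U" "random_variable borel V"
    using indep by (blast dest: indep_var_rv1 indep_var_rv2)+
  have right_cont: "continuous (at_right x) (\<lambda>x. \<bar>ecdf k w x - H x\<bar>)" if "continuous_on UNIV H" for k w H x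
    using that continuous_at_right_ecdf[of x k w]
    by (intro continuous_intros) (auto simp: continuous_on_eq_continuous_within intro: continuous_within_subset)
  have dist_le: "\<bar>ks_dist (ecdf n (\<lambda>i. X i \<omega>)) (ecdf m (\<lambda>j. Y j \<omega>)) - ks_dist F G\<bar> \<le> U \<omega> + V \<omega>" for \<omega>
  proof (rule abs_diff_ks_dist_le[OF ecdf_bounds ecdf_bounds F G])
    show "\<bar>ecdf n (\<lambda>i. X i \<omega>) x - F x\<bar> \<le> U \<omega>" for x
      unfolding U_def by (rule le_SUP_Rats[OF right_cont[OF assms(3)] bdd_above_abs_diff[OF ecdf_bounds F]])
    show "\<bar>ecdf m (\<lambda>j. Y j \<omega>) x - G x\<bar> \<le> V \<omega>" for x
      unfolding V_def by (rule le_SUP_Rats[OF right_cont[OF assms(5)] bdd_above_abs_diff[OF ecdf_bounds G]])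
  qed
  have tailU: "prob {\<omega>\<in>space M. u < U \<omega>} \<le> 2 * exp (- (2 * real n * u\<^sup>2))" if "0 < u" for u
    unfolding U_def using assms(8) n assms(9,3) that by (rule dvoretzky_kiefer_wolfowitz_massart)
  have tailV: "prob {\<omega>\<in>space M. u < V \<omega>} \<le> 2 * exp (- (2 * real m * u\<^sup>2))" if "0 < u" for u
    unfolding V_def using assms(10) m assms(11,5) that by (rule dvoretzky_kiefer_wolfowitz_massart)
  have sqrt_eq: "sqrt (ln 2 / 2) * real k powr (- 1 / 2) = sqrt (ln 2 / (2 * real k))" if "0 < k" for k
  proof -
    \<comment> \<open>This identifies the threshold for z with the sum of the levels at which the
      two tail bounds equal 1, as \<open>prob_sum_le_ks_bound\<close> assumes.\<close>
    have inv: "real k powr (- 1 / 2) = 1 / sqrt (real k)"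
      using that powr_minus_divide[of "real k" "1 / 2"] by (simp add: powr_half_sqrt)
    show ?thesis
      unfolding inv times_divide_eq_right mult_1_right real_sqrt_divide[symmetric] divide_divide_eq_left ..
  qed
  have main: "\<P>(\<omega> in M. \<bar>ks_dist (ecdf n (\<lambda>i. X i \<omega>)) (ecdf m (\<lambda>j. Y j \<omega>)) - ks_dist F G\<bar> > z)
      \<le> ks_bound n m z + ks_bound m n z"
    if z: "z \<ge> sqrt (ln 2 / 2) * (real n powr (- 1 / 2) + real m powr (- 1 / 2))" for z
  proof -
    have "\<P>(\<omega> in M. \<bar>ks_dist (ecdf n (\<lambda>i. X i \<omega>)) (ecdf m (\<lambda>j. Y j \<omega>)) - ks_dist F G\<bar> > z)
        \<le> prob {\<omega>\<in>space M. z < U \<omega> + V \<omega>}"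
      \<comment> \<open>Monotonicity asks for measurability of the larger event, which is expressed
        through the random variables \<open>U\<close> and \<open>V\<close>.\<close>
      using dist_le by (intro finite_measure_mono) (auto intro: order.strict_trans2)
    also have "\<dots> \<le> ks_bound n m z + ks_bound m n z"
      using z unfolding distrib_left sqrt_eq[OF n] sqrt_eq[OF m]
      by (intro prob_sum_le_ks_bound indep n m tailU tailV)
    finally show ?thesis .
  qed
  moreover have "\<P>(\<omega> in M. sqrt (real n / 2) *
      \<bar>ks_dist (ecdf n (\<lambda>i. X i \<omega>)) (ecdf n (\<lambda>j. Y j \<omega>)) - ks_dist F G\<bar> > z) \<le> ks_alpha1 z"
    if nm: "n = m" and z: "z \<ge> sqrt (ln 2)" for z
  proof -
    define r where "r = sqrt (real n / 2)"
    have r: "0 < r" unfolding r_def using n by simp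
    have "0 \<le> sqrt (ln 2 :: real)" by simp
    then have "0 \<le> z" using z by linarith
    \<comment> \<open>For equal sample sizes the threshold is sqrt (ln 2) / r, so the condition on z
      is the general one at z / r.\<close>
    have "sqrt (ln 2 / 2) * (real n powr (- 1 / 2) + real n powr (- 1 / 2)) = 2 * sqrt (ln 2 / (2 * real n))"
      unfolding distrib_left sqrt_eq[OF n] by simp
    also have "\<dots> = sqrt (ln 2) / r"
    proof -
      have "sqrt (ln 2 / (2 * real n)) = sqrt (ln 2 / 4 / (real n / 2))"
        by (rule arg_cong[where f = sqrt]) simp
      also have "\<dots> = sqrt (ln 2) / 2 / r" unfolding r_def real_sqrt_divide real_sqrt_four ..
      finally show ?thesis by simp
    qed
    also have "\<dots> \<le> z / r" using z r by (intro divide_right_mono) auto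
    finally have "\<P>(\<omega> in M. \<bar>ks_dist (ecdf n (\<lambda>i. X i \<omega>)) (ecdf n (\<lambda>j. Y j \<omega>)) - ks_dist F G\<bar> > z / r)
      \<le> ks_bound n n (z / r) + ks_bound n n (z / r)"
      using main[of "z / r"] unfolding nm[symmetric] by blast
    also have "\<dots> = ks_alpha1 z"
      using ks_bound_diag[OF n \<open>0 \<le> z\<close>] unfolding r_def by simp
    finally show ?thesis
      unfolding r_def[symmetric] using r by (simp add: divide_less_eq mult.commute)
  qed
  ultimately show ?thesis by blast
qed

end
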